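(* There exists a sequence $\{\psi_k\}_{k=1}^\infty$ of first order sentences from $L$, with $\psi_k$ of quantifier depth $k$ for every $k=1,2,\dots$, such that for every sequence $\bar p=(p(1),p(2),\dots)$ with $0<p(i)<1$ for all $i$ and $$\frac{\log\left(\prod_{i=1}^n (1-p(i))\right)}{\log n}\longrightarrow 0\quad\text{as } n\to\infty,$$ we have $$\lim_{n\to\infty}\mathrm{Prob}(n,\bar p;\psi_k)=1\quad\text{for every } k=1,2,\dots,$$ but the function $m(k)=\min\{i:\mathrm{Prob}(i,\bar p;\psi_k)>0\}$ grows faster than any recursive function of $k$.
   Context: For a sequence $\bar p=(p(1),p(2),\dots)$ with $0\le p(i)\le 1$, $G(n,\bar p)$ is the random graph with vertex set $[n]=\{1,\dots,n\}$ in which each pair of distinct vertices $v,w$ is an edge with probability $p(|v-w|)$, independently for each pair. $L$ is the first order language of graphs: first order logic with equality whose only other predicate is the binary adjacency predicate. $\mathrm{Prob}(n,\bar p;\psi)$ denotes the probability that $G(n,\bar p)$ satisfies the sentence $\psi$. That $m$ grows faster than any recursive function means: for every (total) recursive function $g:\mathbb N\to\mathbb N$ one has $m(k)>g(k)$ for all sufficiently large $k$. *)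

theory Defs
  imports "HOL-Probability.Probability"
begin

section \<open>The first order language of graphs\<close>

datatype fm =
    Eq nat nat
  | Adj nat nat
  | Neg fm
  | Conj fm fm
  | Disj fm fm
  | Ex nat fm
  | All nat fm

fun free_vars :: "fm \<Rightarrow> nat set" where
  "free_vars (Eq x y) = {x, y}"
| "free_vars (Adj x y) = {x, y}"
| "free_vars (Neg \<phi>) = free_vars \<phi>"
| "free_vars (Conj \<phi> \<psi>) = free_vars \<phi> \<union> free_vars \<psi>"
| "free_vars (Disj \<phi> \<psi>) = free_vars \<phi> \<union> free_vars \<psi>"
| "free_vars (Ex x \<phi>) = free_vars \<phi> - {x}"
| "free_vars (All x \<phi>) = free_vars \<phi> - {x}"

definition sentence :: "fm \<Rightarrow> bool" where
  "sentence \<phi> \<longleftrightarrow> free_vars \<phi> = {}"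

fun qdepth :: "fm \<Rightarrow> nat" where
  "qdepth (Eq x y) = 0"
| "qdepth (Adj x y) = 0"
| "qdepth (Neg \<phi>) = qdepth \<phi>"
| "qdepth (Conj \<phi> \<psi>) = max (qdepth \<phi>) (qdepth \<psi>)"
| "qdepth (Disj \<phi> \<psi>) = max (qdepth \<phi>) (qdepth \<psi>)"
| "qdepth (Ex x \<phi>) = Suc (qdepth \<phi>)"
| "qdepth (All x \<phi>) = Suc (qdepth \<phi>)"

text \<open>
  A graph is given by its vertex set \<open>V\<close> and its set \<open>E\<close> of edges, an edge being a
  two-element set of vertices; \<open>a\<close> assigns vertices to the variables.
\<close>

fun sat :: "'v set \<Rightarrow> 'v set set \<Rightarrow> (nat \<Rightarrow> 'v) \<Rightarrow> fm \<Rightarrow> bool" where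
  "sat V E a (Eq x y) \<longleftrightarrow> a x = a y"
| "sat V E a (Adj x y) \<longleftrightarrow> {a x, a y} \<in> E"
| "sat V E a (Neg \<phi>) \<longleftrightarrow> \<not> sat V E a \<phi>"
| "sat V E a (Conj \<phi> \<psi>) \<longleftrightarrow> sat V E a \<phi> \<and> sat V E a \<psi>"
| "sat V E a (Disj \<phi> \<psi>) \<longleftrightarrow> sat V E a \<phi> \<or> sat V E a \<psi>"
| "sat V E a (Ex x \<phi>) \<longleftrightarrow> (\<exists>v\<in>V. sat V E (a(x := v)) \<phi>)"
| "sat V E a (All x \<phi>) \<longleftrightarrow> (\<forall>v\<in>V. sat V E (a(x := v)) \<phi>)"

definition models :: "'v set \<Rightarrow> 'v set set \<Rightarrow> fm \<Rightarrow> bool" where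
  "models V E \<phi> \<longleftrightarrow> (\<forall>a. range a \<subseteq> V \<longrightarrow> sat V E a \<phi>)"


section \<open>The random graph\<close>

definition vertex_pairs :: "nat \<Rightarrow> (nat \<times> nat) set" where
  "vertex_pairs n = {(v, w). 1 \<le> v \<and> v < w \<and> w \<le> n}"

text \<open>
  Each unordered pair of distinct vertices is represented by its ordered version
  \<open>(v, w)\<close> with \<open>v < w\<close>, for which \<open>\<bar>v - w\<bar> = w - v\<close>; \<open>Pi_pmf\<close> is the product distribution,
  i.e. the coin tosses for distinct pairs are independent. The value \<open>p 0\<close> plays no role.
\<close>

definition random_graph :: "nat \<Rightarrow> (nat \<Rightarrow> real) \<Rightarrow> nat set set pmf" where
  "random_graph n p =
     map_pmf (\<lambda>c. {{v, w} | v w. (v, w) \<in> vertex_pairs n \<and> c (v, w)})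
       (Pi_pmf (vertex_pairs n) False (\<lambda>(v, w). bernoulli_pmf (p (w - v))))"

definition Prob :: "nat \<Rightarrow> (nat \<Rightarrow> real) \<Rightarrow> fm \<Rightarrow> real" where
  "Prob n p \<psi> = measure_pmf.prob (random_graph n p) {E. models {1..n} E \<psi>}"


section \<open>Recursive functions\<close>

text \<open>
  Terms for the partial recursive functions (Kleene). Arities are not recorded: the
  evaluation relation below is read as the graph of a partial function on argument lists,
  and its restriction to lists of any fixed length is a partial recursive function.
\<close>

datatype recf =
    Zero
  | Succ
  | Proj nat
  | Comp recf "recf list"
  | PrimRec recf recf
  | Mu recf

inductive rec_eval :: "recf \<Rightarrow> nat list \<Rightarrow> nat \<Rightarrow> bool" where
  zero: "rec_eval Zero xs 0"
| succ: "rec_eval Succ [x] (Suc x)"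
| proj: "i < length xs \<Longrightarrow> rec_eval (Proj i) xs (xs ! i)"
| comp: "list_all2 (\<lambda>g y. rec_eval g xs y) gs ys \<Longrightarrow> rec_eval f ys z \<Longrightarrow>
    rec_eval (Comp f gs) xs z"
| prim_0: "rec_eval f xs y \<Longrightarrow> rec_eval (PrimRec f g) (0 # xs) y"
| prim_Suc: "rec_eval (PrimRec f g) (n # xs) y \<Longrightarrow> rec_eval g (n # y # xs) z \<Longrightarrow>
    rec_eval (PrimRec f g) (Suc n # xs) z"
| mu: "rec_eval f (n # xs) 0 \<Longrightarrow> (\<And>i. i < n \<Longrightarrow> \<exists>y>0. rec_eval f (i # xs) y) \<Longrightarrow>
    rec_eval (Mu f) xs n"

definition total_recursive :: "(nat \<Rightarrow> nat) \<Rightarrow> bool" where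
  "total_recursive g \<longleftrightarrow> (\<exists>f. \<forall>n. rec_eval f [n] (g n))"

definition faster_than_recursive :: "(nat \<Rightarrow> nat) \<Rightarrow> bool" where
  "faster_than_recursive m \<longleftrightarrow>
     (\<forall>g. total_recursive g \<longrightarrow> (\<forall>\<^sub>F k in sequentially. g k < m k))"

end

theory Submission
  imports Defs
begin

text \<open>
  All edge probabilities lie strictly between \<open>0\<close> and \<open>1\<close>, so every graph on \<open>{1..n}\<close> occurs with
  positive probability and \<open>m(k)\<close> is the size of the smallest finite model of \<open>\<psi>\<^sub>k\<close>. The task
  is therefore purely logical on one side (sentences of depth \<open>k\<close> whose smallest finite model is huge)
  and probabilistic on the other (these sentences must hold almost surely in a sparse random graph).

  The logical side. Choose a vertex \<open>c\<close> and regard its neighbours as numbers. Every vertex \<open>w\<close>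
  codes a binary relation on the numbers: \<open>x\<close> is related to \<open>y\<close> if there are vertices \<open>p\<close> and \<open>q\<close>
  such that \<open>w - p - x\<close> and \<open>p - q - y\<close> are paths. A second vertex \<open>s\<close> is required to code a strict linear
  order; in a finite graph this identifies the numbers with an initial segment of \<open>\<nat>\<close>.
  For each term \<open>f\<close> for a partial recursive function there is a formula that says ``\<open>f(xs) = y\<close>'',
  where the table of values needed for a primitive recursion is a relation coded by some vertex. A vertex
  that claims to code a table can be checked row by row, and each row that it contains is then correct. So the
  formula is sound in every finite graph whatever else the graph contains (\<open>computes_fm_sound\<close>).
  It is also complete if the graph codes all relations on a long enough segment
  (\<open>computes_fm_complete\<close>). By repeated doubling, a formula of depth \<open>r + 3\<close> defines
  the addition of \<open>2 ^ r\<close>. Hence a sentence of depth \<open>r + D\<close>, with \<open>D\<close> depending only on \<open>f\<close>, can say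
  that \<open>f\<close> has a value among the numbers at each \<open>n < 2 ^ r\<close>; all its finite models have
  more than \<open>f(n)\<close> vertices for each of these \<open>n\<close>. The sentence \<open>\<psi>\<^sub>k\<close> is
  the conjunction of all such sentences of depth at most \<open>k\<close> for the first \<open>k\<close> terms
  \<open>f\<close>, as far as they denote total functions. No decision procedure for totality is involved: the sequence
  merely exists, and a computable one could not grow as claimed. Since \<open>2 ^ (k - D) > k\<close> for large \<open>k\<close>, it beats each recursive function.

  The probabilistic side. The sentence \<open>\<psi>\<^sub>k\<close> holds in each graph that contains a certain
  finite graph as a union of connected components (\<open>isolated_gadget_rich\<close>): \<open>c\<close>, \<open>s\<close> and
  the vertices that code tables can be taken there, all numbers are neighbours of \<open>c\<close>, and the paths that decide
  which relations are coded cannot leave the component.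
  So it suffices that any fixed finite graph on \<open>h\<close> vertices occurs in this way almost surely
  (\<open>isolated_copy_tendsto_1\<close>). Cut \<open>{1..n}\<close> into consecutive blocks of length \<open>h\<close>. The assumption on
  \<open>p\<close> says that \<open>\<Prod>i\<le>n. 1 - p i\<close> is \<open>n\<close> to the power \<open>-o(1)\<close>, hence each block carries an isolated copy
  with probability at least \<open>L\<close>, where \<open>L\<close> is again \<open>n\<close> to the power \<open>-o(1)\<close>.
  There are about \<open>n / h\<close> blocks, and an edge touches at
  most two of them; this limited dependence is enough for the second moment method to bound the probability that no block
  succeeds by \<open>2 h / (n L\<^sup>2)\<close>, up to a factor tending to \<open>1\<close> (\<open>prob_no_agreement\<close>).
\<close>

section \<open>Evaluation of recursive functions\<close>

text \<open>
  A model of the sentences below only provides some value \<open>y\<close> with \<open>rec_eval f [n] y\<close>;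
  uniqueness is what turns it into the value of the given recursive function.
\<close>
lemma rec_eval_deterministic: "rec_eval f xs y \<Longrightarrow> rec_eval f xs z \<Longrightarrow> y = z"
proof (induction f arbitrary: xs y z)
  case Zero
  then show ?case by (auto elim: rec_eval.cases)
next
  case Succ
  then show ?case by (auto elim: rec_eval.cases)
next
  case (Proj i)
  then show ?case by (auto elim: rec_eval.cases)
next
  case (Comp f gs)
  from Comp.prems(1) obtain ys where ys: "list_all2 (\<lambda>g y. rec_eval g xs y) gs ys" "rec_eval f ys y"
    by (auto elim: rec_eval.cases)
  from Comp.prems(2) obtain zs where zs: "list_all2 (\<lambda>g y. rec_eval g xs y) gs zs" "rec_eval f zs z"
    by (auto elim: rec_eval.cases)
  have "ys = zs"
    using ys(1) zs(1) Comp.IH(2)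
    by (auto simp: list_all2_conv_all_nth intro!: nth_equalityI) (metis nth_mem)
  with ys zs show ?case using Comp.IH(1) by blast
next
  case (PrimRec f g)
  have "rec_eval (PrimRec f g) (n # ws) y \<Longrightarrow> rec_eval (PrimRec f g) (n # ws) z \<Longrightarrow> y = z" for n ws y z
  proof (induction n arbitrary: y z)
    case 0
    from 0 show ?case
      by (auto elim!: rec_eval.cases[of "PrimRec f g"] intro: PrimRec.IH)
  next
    case (Suc n)
    from Suc.prems(1) obtain y' where "rec_eval (PrimRec f g) (n # ws) y'" "rec_eval g (n # y' # ws) y"
      by (auto elim: rec_eval.cases)
    moreover from Suc.prems(2) obtain z' where "rec_eval (PrimRec f g) (n # ws) z'"
        "rec_eval g (n # z' # ws) z"
      by (auto elim: rec_eval.cases)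
    ultimately show ?case using Suc.IH PrimRec.IH(2) by blast
  qed
  moreover obtain n ws where "xs = n # ws" using PrimRec.prems(1) by (auto elim: rec_eval.cases)
  ultimately show ?case using PrimRec.prems by blast
next
  case (Mu f)
  from Mu.prems(1) have y: "rec_eval f (y # xs) 0" "\<And>i. i < y \<Longrightarrow> \<exists>u>0. rec_eval f (i # xs) u"
    by (auto elim: rec_eval.cases)
  from Mu.prems(2) have z: "rec_eval f (z # xs) 0" "\<And>i. i < z \<Longrightarrow> \<exists>u>0. rec_eval f (i # xs) u"
    by (auto elim: rec_eval.cases)
  show ?case
    using y z Mu.IH by (metis less_numeral_extra(3) linorder_neqE_nat)
qed

text \<open>
  The recursion is unrolled into its table of values \<open>Y\<close>, the object that a vertex of the graph will code.
\<close>
lemma rec_eval_PrimRec_iff: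
  "rec_eval (PrimRec f g) (n # xs) z \<longleftrightarrow>
     (\<exists>Y. Y n = z \<and> rec_eval f xs (Y 0) \<and> (\<forall>i<n. rec_eval g (i # Y i # xs) (Y (Suc i))))"
  (is "?L n z \<longleftrightarrow> ?R n z")
proof
  show "?L n z \<Longrightarrow> ?R n z"
  proof (induction n arbitrary: z)
    case 0
    then have "rec_eval f xs z" by (auto elim: rec_eval.cases)
    then show ?case by (intro exI[of _ "\<lambda>_. z"]) auto
  next
    case (Suc n)
    from Suc.prems obtain y where y: "?L n y" "rec_eval g (n # y # xs) z"
      by (auto elim: rec_eval.cases)
    from Suc.IH[OF y(1)] obtain Y where Y: "Y n = y" "rec_eval f xs (Y 0)"
      "\<forall>i<n. rec_eval g (i # Y i # xs) (Y (Suc i))" by auto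
    show ?case
      using Y y(2) by (intro exI[of _ "Y(Suc n := z)"]) (auto simp: less_Suc_eq)
  qed
next
  assume "?R n z"
  then obtain Y where Y: "Y n = z" "rec_eval f xs (Y 0)"
    "\<forall>i<n. rec_eval g (i # Y i # xs) (Y (Suc i))" by auto
  have "i \<le> n \<Longrightarrow> ?L i (Y i)" for i
    by (induction i) (use Y in \<open>auto intro: rec_eval.intros\<close>)
  with Y show "?L n z" by auto
qed

section \<open>Numbers and relations inside a graph\<close>

definition nbhd :: "'v set \<Rightarrow> 'v set set \<Rightarrow> 'v \<Rightarrow> 'v set" where
  "nbhd V E c = {v \<in> V. {c, v} \<in> E}"

text \<open>
  The vertex \<open>p\<close> stands for the ordered pair \<open>(x, y)\<close>. An undirected edge cannot tell the two
  components apart, so the second one is attached through the intermediate vertex \<open>q\<close>.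
\<close>
definition coded :: "'v set \<Rightarrow> 'v set set \<Rightarrow> 'v \<Rightarrow> 'v \<Rightarrow> 'v \<Rightarrow> bool" where
  "coded V E w x y \<longleftrightarrow> (\<exists>p\<in>V. \<exists>q\<in>V. {w, p} \<in> E \<and> {p, x} \<in> E \<and> {p, q} \<in> E \<and> {q, y} \<in> E)"

definition numbering :: "'v set \<Rightarrow> 'v set set \<Rightarrow> 'v \<Rightarrow> 'v \<Rightarrow> nat \<Rightarrow> ('v \<Rightarrow> nat) \<Rightarrow> bool" where
  "numbering V E c s m val \<longleftrightarrow> bij_betw val (nbhd V E c) {..<m} \<and>
     (\<forall>x\<in>nbhd V E c. \<forall>y\<in>nbhd V E c. coded V E s x y \<longleftrightarrow> val x < val y)"

text \<open>
  Rich graphs code all relations between numbers: inside them first order quantifiers over vertices act as second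
  order quantifiers over relations on \<open>{..<m}\<close>.
\<close>
definition rich :: "'v set \<Rightarrow> 'v set set \<Rightarrow> 'v \<Rightarrow> 'v \<Rightarrow> nat \<Rightarrow> ('v \<Rightarrow> nat) \<Rightarrow> bool" where
  "rich V E c s m val \<longleftrightarrow> numbering V E c s m val \<and>
     (\<forall>R. R \<subseteq> {..<m} \<times> {..<m} \<longrightarrow>
        (\<exists>w\<in>V. \<forall>x\<in>nbhd V E c. \<forall>y\<in>nbhd V E c. coded V E w x y \<longleftrightarrow> (val x, val y) \<in> R))"

lemma numbering_bound: "numbering V E c s m val \<Longrightarrow> x \<in> nbhd V E c \<Longrightarrow> val x < m"
  by (auto simp: numbering_def bij_betw_def)

lemma numbering_inj:
  "numbering V E c s m val \<Longrightarrow> x \<in> nbhd V E c \<Longrightarrow> y \<in> nbhd V E c \<Longrightarrow> val x = val y \<longleftrightarrow> x = y"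
  by (auto simp: numbering_def bij_betw_def inj_on_def)

lemma numbering_surj: "numbering V E c s m val \<Longrightarrow> i < m \<Longrightarrow> \<exists>x\<in>nbhd V E c. val x = i"
  unfolding numbering_def bij_betw_def by (metis imageE lessThan_iff)

lemma numbering_less_iff:
  "numbering V E c s m val \<Longrightarrow> x \<in> nbhd V E c \<Longrightarrow> y \<in> nbhd V E c \<Longrightarrow>
     coded V E s x y \<longleftrightarrow> val x < val y"
  by (auto simp: numbering_def)

lemma numbering_quantifiers:
  assumes "numbering V E c s m val"
  shows "(\<exists>x\<in>nbhd V E c. P (val x)) \<longleftrightarrow> (\<exists>i<m. P i)"
    and "(\<forall>x\<in>nbhd V E c. P (val x)) \<longleftrightarrow> (\<forall>i<m. P i)"
proof -
  have A: "{..<m} = val ` nbhd V E c" using assms by (simp add: numbering_def bij_betw_def)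
  show "(\<exists>x\<in>nbhd V E c. P (val x)) \<longleftrightarrow> (\<exists>i<m. P i)"
    unfolding lessThan_iff[symmetric] A by auto
  show "(\<forall>x\<in>nbhd V E c. P (val x)) \<longleftrightarrow> (\<forall>i<m. P i)"
    unfolding lessThan_iff[symmetric] A by auto
qed

text \<open>
  Counting predecessors is strictly monotone, hence injective, and takes values below the cardinality.
\<close>
lemma finite_linear_order_numbering:
  fixes A :: "'v set"
  assumes "finite A" and irr: "\<And>x. x \<in> A \<Longrightarrow> \<not> lt x x"
    and tr: "\<And>x y z. x \<in> A \<Longrightarrow> y \<in> A \<Longrightarrow> z \<in> A \<Longrightarrow> lt x y \<Longrightarrow> lt y z \<Longrightarrow> lt x z"
    and tot: "\<And>x y. x \<in> A \<Longrightarrow> y \<in> A \<Longrightarrow> lt x y \<or> x = y \<or> lt y x"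
  obtains val :: "'v \<Rightarrow> nat" where "bij_betw val A {..<card A}"
    "\<And>x y. x \<in> A \<Longrightarrow> y \<in> A \<Longrightarrow> lt x y \<longleftrightarrow> val x < val y"
proof -
  define val where "val x = card {z \<in> A. lt z x}" for x
  have mono: "val x < val y" if "x \<in> A" "y \<in> A" "lt x y" for x y
  proof -
    have "{z \<in> A. lt z x} \<subseteq> {z \<in> A. lt z y}" using that tr by blast
    moreover have "x \<in> {z \<in> A. lt z y}" "x \<notin> {z \<in> A. lt z x}" using that irr by auto
    ultimately have "{z \<in> A. lt z x} \<subset> {z \<in> A. lt z y}" by blast
    then show ?thesis unfolding val_def using assms(1) by (intro psubset_card_mono) auto
  qed
  have iff: "lt x y \<longleftrightarrow> val x < val y" if "x \<in> A" "y \<in> A" for x y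
    using mono tot that by (metis less_asym less_irrefl)
  have "inj_on val A"
    using tot mono by (intro inj_onI) (metis less_irrefl)
  moreover have "val x < card A" if "x \<in> A" for x
  proof -
    have "{z \<in> A. lt z x} \<subset> A" using that irr by blast
    then show ?thesis unfolding val_def using assms(1) by (intro psubset_card_mono)
  qed
  hence "val ` A \<subseteq> {..<card A}" by auto
  ultimately have "val ` A = {..<card A}"
    by (simp add: card_image card_subset_eq)
  with \<open>inj_on val A\<close> have "bij_betw val A {..<card A}" by (simp add: bij_betw_def)
  with iff show thesis by (rule that[rotated])
qed

section \<open>Formulas for orders, numbers and recursive functions\<close>

text \<open>
  Throughout, variable \<open>0\<close> denotes the centre \<open>c\<close> whose neighbours are the numbers and variable
  \<open>1\<close> the vertex \<open>s\<close> that codes their order; numbers are denoted by variables from \<open>2\<close> on.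
\<close>
abbreviation ExA :: "nat \<Rightarrow> fm \<Rightarrow> fm" where
  "ExA x \<phi> \<equiv> Ex x (Conj (Adj 0 x) \<phi>)"

abbreviation AllA :: "nat \<Rightarrow> fm \<Rightarrow> fm" where
  "AllA x \<phi> \<equiv> All x (Disj (Neg (Adj 0 x)) \<phi>)"

abbreviation Imp :: "fm \<Rightarrow> fm \<Rightarrow> fm" where
  "Imp \<phi> \<psi> \<equiv> Disj (Neg \<phi>) \<psi>"

abbreviation Falsum :: fm where
  "Falsum \<equiv> Neg (Eq 0 0)"

definition fresh :: "nat list \<Rightarrow> nat" where
  "fresh xs = Suc (Suc (sum_list xs))"

lemma less_fresh: "x \<in> set xs \<Longrightarrow> x < fresh xs"
  using member_le_sum_list[of x xs] by (simp add: fresh_def)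

lemma fresh_ge_2: "2 \<le> fresh xs"
  by (simp add: fresh_def)

definition coded_fm :: "nat \<Rightarrow> nat \<Rightarrow> nat \<Rightarrow> fm" where
  "coded_fm w x y = (let p = fresh [w, x, y]; q = Suc p in
     Ex p (Ex q (Conj (Adj w p) (Conj (Adj p x) (Conj (Adj p q) (Adj q y))))))"

abbreviation less_fm :: "nat \<Rightarrow> nat \<Rightarrow> fm" where
  "less_fm \<equiv> coded_fm 1"

definition zero_fm :: "nat \<Rightarrow> fm" where
  "zero_fm x = (let z = fresh [x] in AllA z (Neg (less_fm z x)))"

definition succ_fm :: "nat \<Rightarrow> nat \<Rightarrow> fm" where
  "succ_fm x y = (let z = fresh [x, y] in
     Conj (less_fm x y) (AllA z (Neg (Conj (less_fm x z) (less_fm z y)))))"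

text \<open>
  Doubling costs one quantifier, so adding \<open>2 ^ r\<close> is expressible with depth \<open>r + O(1)\<close>.
\<close>
fun add_power_fm :: "nat \<Rightarrow> nat \<Rightarrow> nat \<Rightarrow> fm" where
  "add_power_fm 0 x y = succ_fm x y"
| "add_power_fm (Suc r) x y = (let z = fresh [x, y] in
     ExA z (Conj (add_power_fm r x z) (add_power_fm r z y)))"

definition order_fm :: fm where
  "order_fm = AllA 2 (Conj (Neg (less_fm 2 2)) (AllA 3
     (Conj (Disj (less_fm 2 3) (Disj (Eq 2 3) (less_fm 3 2)))
        (AllA 4 (Imp (Conj (less_fm 2 3) (less_fm 3 4)) (less_fm 2 4))))))"

lemma size_nth_le: "i < length xs \<Longrightarrow> size (xs ! i) \<le> size_list size xs"
  by (rule size_list_estimation'[OF nth_mem]) auto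

text \<open>
  The formula for ``the value of \<open>f\<close> at \<open>xs\<close> is \<open>y\<close>'', where \<open>xs\<close> and \<open>y\<close> are variables.
  Arguments of the wrong number have no value, so they yield \<open>Falsum\<close>. In the case of primitive recursion the vertex
  \<open>w\<close> codes a set of rows \<open>(i, z)\<close> of the table of values, each of which is justified either by the base case
  or by another row. Two rows with the same number do not contradict this: both are then correct, hence equal.
\<close>
function computes_fm :: "recf \<Rightarrow> nat list \<Rightarrow> nat \<Rightarrow> fm" where
  "computes_fm Zero xs y = zero_fm y"
| "computes_fm Succ xs y = (if length xs = 1 then succ_fm (hd xs) y else Falsum)"
| "computes_fm (Proj i) xs y = (if i < length xs then Eq (xs ! i) y else Falsum)"
| "computes_fm (Comp f gs) xs y = (let v = fresh (y # xs); zs = [v..<v + length gs] in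
     foldr ExA zs (foldr Conj (map (\<lambda>i. computes_fm (gs ! i) xs (v + i)) [0..<length gs]) (computes_fm f zs y)))"
| "computes_fm (PrimRec f g) xs y = (case xs of [] \<Rightarrow> Falsum | n # ws \<Rightarrow>
     (let w = fresh (y # xs); i = w + 1; z = w + 2; j = w + 3; u = w + 4 in
       Ex w (Conj (coded_fm w n y)
         (AllA i (AllA z (Imp (coded_fm w i z)
           (Disj (Conj (zero_fm i) (computes_fm f ws z))
             (ExA j (ExA u (Conj (succ_fm j i) (Conj (coded_fm w j u) (computes_fm g (j # u # ws) z))))))))))))"
| "computes_fm (Mu f) xs y = (let v = fresh (y # xs); i = v + 1 in
     Conj (ExA v (Conj (zero_fm v) (computes_fm f (y # xs) v)))
       (AllA i (Imp (less_fm i y) (ExA v (Conj (Neg (zero_fm v)) (computes_fm f (i # xs) v))))))"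
  by pat_completeness auto
termination
  by (relation "Wellfounded.measure (\<lambda>(f, _). size f)") (auto dest!: size_nth_le)

lemma free_vars_coded_fm: "free_vars (coded_fm w x y) = {w, x, y}"
  by (auto simp: coded_fm_def Let_def fresh_def)

lemma free_vars_zero_fm: "free_vars (zero_fm x) \<subseteq> {0, 1, x}"
  by (auto simp: zero_fm_def Let_def free_vars_coded_fm)

lemma free_vars_succ_fm: "free_vars (succ_fm x y) \<subseteq> {0, 1, x, y}"
  by (auto simp: succ_fm_def Let_def free_vars_coded_fm)

lemma free_vars_add_power_fm: "free_vars (add_power_fm r x y) \<subseteq> {0, 1, x, y}"
proof (induction r arbitrary: x y)
  case 0
  then show ?case using free_vars_succ_fm by simp
next
  case (Suc r)
  from Suc[of x "fresh [x, y]"] Suc[of "fresh [x, y]" y] show ?case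
    by (auto simp: Let_def)
qed

lemma free_vars_order_fm: "free_vars order_fm \<subseteq> {0, 1}"
  by (auto simp: order_fm_def free_vars_coded_fm)

lemma free_vars_foldr_Conj:
  "free_vars (foldr Conj \<phi>s \<phi>) = free_vars \<phi> \<union> (\<Union>\<psi>\<in>set \<phi>s. free_vars \<psi>)"
  by (induction \<phi>s) auto

lemma free_vars_foldr_ExA: "free_vars (foldr ExA zs \<phi>) \<subseteq> {0} \<union> (free_vars \<phi> - set zs)"
  by (induction zs) auto

text \<open>
  An upper bound \<open>S\<close> for the free variables is pushed through a formula, growing by the bound variable
  at each quantifier; computing the set itself instead produces large nested differences.
\<close>
lemma free_vars_subset_intros:
  "free_vars \<phi> \<subseteq> S \<Longrightarrow> free_vars (Neg \<phi>) \<subseteq> S"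
  "free_vars \<phi> \<subseteq> S \<Longrightarrow> free_vars \<psi> \<subseteq> S \<Longrightarrow> free_vars (Conj \<phi> \<psi>) \<subseteq> S"
  "free_vars \<phi> \<subseteq> S \<Longrightarrow> free_vars \<psi> \<subseteq> S \<Longrightarrow> free_vars (Disj \<phi> \<psi>) \<subseteq> S"
  "free_vars \<phi> \<subseteq> insert x S \<Longrightarrow> free_vars (Ex x \<phi>) \<subseteq> S"
  "free_vars \<phi> \<subseteq> insert x S \<Longrightarrow> free_vars (All x \<phi>) \<subseteq> S"
  by auto

lemma free_vars_computes_fm: "free_vars (computes_fm f xs y) \<subseteq> {0, 1, y} \<union> set xs"
proof (induction f xs y rule: computes_fm.induct)
  case (1 xs y)
  then show ?case using free_vars_zero_fm by fastforce
next
  case (2 xs y)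
  then show ?case using free_vars_succ_fm[of "hd xs" y] by (cases xs) auto
next
  case (3 i xs y)
  then show ?case by auto
next
  case (4 f gs xs y)
  define v where "v = fresh (y # xs)"
  define zs where "zs = [v..<v + length gs]"
  have 1: "free_vars (computes_fm f zs y) - set zs \<subseteq> {0, 1, y}"
    using 4(1)[OF v_def zs_def] by auto
  have 2: "free_vars (computes_fm (gs ! i) xs (v + i)) - set zs \<subseteq> {0, 1} \<union> set xs" if "i < length gs" for i
    using 4(2)[OF v_def zs_def, of i] that by (auto simp: zs_def)
  let ?\<phi> = "foldr Conj (map (\<lambda>i. computes_fm (gs ! i) xs (v + i)) [0..<length gs]) (computes_fm f zs y)"
  have "free_vars (computes_fm (Comp f gs) xs y) \<subseteq> {0} \<union> (free_vars ?\<phi> - set zs)"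
    unfolding computes_fm.simps Let_def v_def[symmetric] zs_def[symmetric] by (rule free_vars_foldr_ExA)
  also have "free_vars ?\<phi> - set zs = (free_vars (computes_fm f zs y) - set zs) \<union>
      (\<Union>i\<in>{..<length gs}. free_vars (computes_fm (gs ! i) xs (v + i)) - set zs)"
    unfolding free_vars_foldr_Conj by (auto simp: atLeast0LessThan)
  also have "{0} \<union> \<dots> \<subseteq> {0, 1, y} \<union> set xs" using 1 2 by blast
  finally show ?case .
next
  case (5 f g xs y)
  show ?case
  proof (cases xs)
    case Nil
    then show ?thesis by simp
  next
    case (Cons n ws)
    define w where "w = fresh (y # xs)"
    note IH = 5(1)[OF Cons w_def refl refl refl refl] 5(2)[OF Cons w_def refl refl refl refl]
    show ?thesis
      unfolding computes_fm.simps Let_def w_def[symmetric] unfolding Cons list.case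
      by (intro free_vars_subset_intros;
          (rule order.trans[OF free_vars_zero_fm] order.trans[OF free_vars_succ_fm]
             order.trans[OF IH(1)] order.trans[OF IH(2)])?) (auto simp: free_vars_coded_fm)
  qed
next
  case (6 f xs y)
  define v where "v = fresh (y # xs)"
  show ?case
    unfolding computes_fm.simps Let_def v_def[symmetric]
    by (intro free_vars_subset_intros;
        (rule order.trans[OF free_vars_zero_fm] order.trans[OF 6(1)[OF v_def refl]]
           order.trans[OF 6(2)[OF v_def refl]])?) (auto simp: free_vars_coded_fm)
qed

section \<open>Meaning of the formulas\<close>

lemma sat_ExA:
  "x \<noteq> 0 \<Longrightarrow> sat V E a (ExA x \<phi>) \<longleftrightarrow> (\<exists>v\<in>nbhd V E (a 0). sat V E (a(x := v)) \<phi>)"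
  by (auto simp: nbhd_def)

lemma sat_AllA:
  "x \<noteq> 0 \<Longrightarrow> sat V E a (AllA x \<phi>) \<longleftrightarrow> (\<forall>v\<in>nbhd V E (a 0). sat V E (a(x := v)) \<phi>)"
  by (auto simp: nbhd_def)

text \<open>
  A block of quantifiers chooses one new assignment \<open>b\<close> that differs from \<open>a\<close> only on the block.
\<close>
lemma sat_foldr_ExA:
  assumes "0 \<notin> set zs"
  shows "sat V E a (foldr ExA zs \<phi>) \<longleftrightarrow>
    (\<exists>b. (\<forall>x. x \<notin> set zs \<longrightarrow> b x = a x) \<and> (\<forall>x\<in>set zs. b x \<in> nbhd V E (a 0)) \<and> sat V E b \<phi>)"
  using assms
proof (induction zs arbitrary: a)
  case Nil
  have "(\<forall>x. b x = a x) \<longleftrightarrow> b = a" for b by (auto simp: fun_eq_iff)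
  then show ?case by simp
next
  case (Cons z zs)
  from Cons.prems have z: "z \<noteq> 0" "0 \<notin> set zs" by auto
  have *: "sat V E (a(z := v)) (foldr ExA zs \<phi>) \<longleftrightarrow>
    (\<exists>b. (\<forall>x. x \<notin> set zs \<longrightarrow> b x = (a(z := v)) x) \<and> (\<forall>x\<in>set zs. b x \<in> nbhd V E (a 0)) \<and> sat V E b \<phi>)" for v
    using Cons.IH[OF z(2), of "a(z := v)"] z(1) by (simp only: fun_upd_other neq_commute[of 0] not_False_eq_True)
  show ?case
    unfolding foldr.simps comp_apply sat_ExA[OF z(1)] *
  proof safe
    fix v b
    assume "v \<in> nbhd V E (a 0)" "\<forall>x. x \<notin> set zs \<longrightarrow> b x = (a(z := v)) x"
      "\<forall>x\<in>set zs. b x \<in> nbhd V E (a 0)" "sat V E b \<phi>"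
    then show "\<exists>b. (\<forall>x. x \<notin> set (z # zs) \<longrightarrow> b x = a x) \<and>
        (\<forall>x\<in>set (z # zs). b x \<in> nbhd V E (a 0)) \<and> sat V E b \<phi>"
      by (intro exI[of _ b]) (cases "z \<in> set zs"; auto)
  next
    fix b
    assume b: "\<forall>x. x \<notin> set (z # zs) \<longrightarrow> b x = a x"
      "\<forall>x\<in>set (z # zs). b x \<in> nbhd V E (a 0)" "sat V E b \<phi>"
    then show "\<exists>v\<in>nbhd V E (a 0). \<exists>b. (\<forall>x. x \<notin> set zs \<longrightarrow> b x = (a(z := v)) x) \<and>
        (\<forall>x\<in>set zs. b x \<in> nbhd V E (a 0)) \<and> sat V E b \<phi>"
      by (intro bexI[of _ "b z"] exI[of _ b]) auto
  qed
qed

lemma sat_foldr_Conj: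
  "sat V E a (foldr Conj \<phi>s \<phi>) \<longleftrightarrow> sat V E a \<phi> \<and> (\<forall>\<psi>\<in>set \<phi>s. sat V E a \<psi>)"
  by (induction \<phi>s) auto

lemma sat_coded_fm: "sat V E a (coded_fm w x y) \<longleftrightarrow> coded V E (a w) (a x) (a y)"
  by (simp add: coded_fm_def Let_def coded_def fresh_def)

definition numbers_at :: "'v set \<Rightarrow> 'v set set \<Rightarrow> (nat \<Rightarrow> 'v) \<Rightarrow> nat set \<Rightarrow> bool" where
  "numbers_at V E a X \<longleftrightarrow> (\<forall>x\<in>X. 2 \<le> x \<and> a x \<in> nbhd V E (a 0))"

lemma sat_less_fm:
  assumes "numbering V E (a 0) (a 1) m val" "a x \<in> nbhd V E (a 0)" "a y \<in> nbhd V E (a 0)"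
  shows "sat V E a (less_fm x y) \<longleftrightarrow> val (a x) < val (a y)"
  using assms by (simp add: sat_coded_fm numbering_less_iff)

lemma sat_zero_fm:
  assumes num: "numbering V E (a 0) (a 1) m val" and x: "2 \<le> x" "a x \<in> nbhd V E (a 0)"
  shows "sat V E a (zero_fm x) \<longleftrightarrow> val (a x) = 0"
proof -
  have f: "fresh [x] \<noteq> 0" "fresh [x] \<noteq> 1" "fresh [x] \<noteq> x" by (auto simp: fresh_def)
  have "sat V E a (zero_fm x) \<longleftrightarrow> (\<forall>v\<in>nbhd V E (a 0). \<not> coded V E (a 1) v (a x))"
    unfolding zero_fm_def Let_def sat_AllA[OF f(1)] using f x(1) by (simp add: sat_coded_fm)
  also have "\<dots> \<longleftrightarrow> (\<forall>v\<in>nbhd V E (a 0). \<not> val v < val (a x))"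
    using numbering_less_iff[OF num _ x(2)] by blast
  also have "\<dots> \<longleftrightarrow> val (a x) = 0"
    unfolding numbering_quantifiers(2)[OF num, of "\<lambda>i. \<not> i < val (a x)"]
    using numbering_bound[OF num x(2)] by auto
  finally show ?thesis .
qed

lemma sat_succ_fm:
  assumes num: "numbering V E (a 0) (a 1) m val" and x: "numbers_at V E a {x, y}"
  shows "sat V E a (succ_fm x y) \<longleftrightarrow> val (a y) = Suc (val (a x))"
proof -
  let ?z = "fresh [x, y]"
  have f: "?z \<noteq> 0" "?z \<noteq> 1" "?z \<noteq> x" "?z \<noteq> y" by (auto simp: fresh_def)
  have x: "2 \<le> x" "2 \<le> y" "a x \<in> nbhd V E (a 0)" "a y \<in> nbhd V E (a 0)"
    using x by (auto simp: numbers_at_def)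
  have "sat V E a (succ_fm x y) \<longleftrightarrow> coded V E (a 1) (a x) (a y) \<and>
      (\<forall>v\<in>nbhd V E (a 0). \<not> (coded V E (a 1) (a x) v \<and> coded V E (a 1) v (a y)))"
    unfolding succ_fm_def Let_def sat.simps(4) sat_AllA[OF f(1)] using f x
    by (simp add: sat_coded_fm)
  also have "\<dots> \<longleftrightarrow> val (a x) < val (a y) \<and>
      (\<forall>v\<in>nbhd V E (a 0). \<not> (val (a x) < val v \<and> val v < val (a y)))"
    using numbering_less_iff[OF num x(3)] numbering_less_iff[OF num _ x(4)] x by blast
  also have "\<dots> \<longleftrightarrow> val (a y) = Suc (val (a x))"
    unfolding numbering_quantifiers(2)[OF num, of "\<lambda>i. \<not> (val (a x) < i \<and> i < val (a y))"]
    using numbering_bound[OF num x(4)] by (auto dest: spec[of _ "Suc (val (a x))"])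
  finally show ?thesis .
qed

lemma sat_add_power_fm:
  assumes "numbering V E (a 0) (a 1) m val" "numbers_at V E a {x, y}"
  shows "sat V E a (add_power_fm r x y) \<longleftrightarrow> val (a y) = val (a x) + 2 ^ r"
  using assms
proof (induction r arbitrary: a x y)
  case 0
  then show ?case by (simp add: sat_succ_fm)
next
  case (Suc r)
  let ?z = "fresh [x, y]"
  have f: "?z \<noteq> 0" "?z \<noteq> 1" "?z \<noteq> x" "?z \<noteq> y" "2 \<le> ?z" by (auto simp: fresh_def)
  have x: "2 \<le> x" "2 \<le> y" "a x \<in> nbhd V E (a 0)" "a y \<in> nbhd V E (a 0)"
    using Suc.prems(2) by (auto simp: numbers_at_def)
  note num = Suc.prems(1)
  have "sat V E a (add_power_fm (Suc r) x y) \<longleftrightarrow>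
      (\<exists>v\<in>nbhd V E (a 0). val v = val (a x) + 2 ^ r \<and> val (a y) = val v + 2 ^ r)"
    unfolding add_power_fm.simps Let_def sat_ExA[OF f(1)] sat.simps(4)
    using Suc.IH f x num by (intro bex_cong refl) (simp add: numbers_at_def)
  also have "\<dots> \<longleftrightarrow> val (a y) = val (a x) + 2 ^ Suc r"
    unfolding numbering_quantifiers(1)[OF num,
        of "\<lambda>i. i = val (a x) + 2 ^ r \<and> val (a y) = i + 2 ^ r"]
    using numbering_bound[OF num x(4)] by auto
  finally show ?case .
qed

lemma sat_order_fm:
  "sat V E a order_fm \<longleftrightarrow>
    (let A = nbhd V E (a 0); lt = coded V E (a 1) in
      \<forall>x\<in>A. \<not> lt x x \<and> (\<forall>y\<in>A. (lt x y \<or> x = y \<or> lt y x) \<and>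
        (\<forall>z\<in>A. lt x y \<and> lt y z \<longrightarrow> lt x z)))"
proof -
  have ne: "(2::nat) \<noteq> 0" "(3::nat) \<noteq> 0" "(4::nat) \<noteq> 0" "(2::nat) \<noteq> 1" "(3::nat) \<noteq> 1" "(4::nat) \<noteq> 1"
    "(2::nat) \<noteq> 3" "(2::nat) \<noteq> 4" "(3::nat) \<noteq> 4" by simp_all
  show ?thesis
    unfolding order_fm_def Let_def
    by (simp only: sat_AllA[OF ne(1)] sat_AllA[OF ne(2)] sat_AllA[OF ne(3)] sat.simps(1,3-5)
        sat_coded_fm imp_conv_disj fun_upd_same fun_upd_other ne ne[symmetric] not_False_eq_True)
qed

text \<open>
  Finiteness enters here: the axioms of a strict linear order characterise the initial segments of \<open>\<nat>\<close>
  only among finite structures.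
\<close>
lemma order_fm_numbering:
  assumes "sat V E a order_fm" "finite V"
  obtains val where "numbering V E (a 0) (a 1) (card (nbhd V E (a 0))) val"
proof -
  let ?A = "nbhd V E (a 0)" and ?lt = "coded V E (a 1)"
  have ord: "\<forall>x\<in>?A. \<not> ?lt x x \<and> (\<forall>y\<in>?A. (?lt x y \<or> x = y \<or> ?lt y x) \<and>
      (\<forall>z\<in>?A. ?lt x y \<and> ?lt y z \<longrightarrow> ?lt x z))"
    using assms(1) unfolding sat_order_fm Let_def .
  obtain val where "bij_betw val ?A {..<card ?A}"
    "\<And>x y. x \<in> ?A \<Longrightarrow> y \<in> ?A \<Longrightarrow> ?lt x y \<longleftrightarrow> val x < val y"
  proof (rule finite_linear_order_numbering[of ?A ?lt])
    show "finite ?A" using assms(2) by (simp add: nbhd_def)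
  qed (use ord in blast)+
  then show thesis by (intro that[of val]) (auto simp: numbering_def)
qed

lemma numbering_sat_order_fm:
  assumes num: "numbering V E (a 0) (a 1) m val"
  shows "sat V E a order_fm"
proof -
  let ?A = "nbhd V E (a 0)" and ?lt = "coded V E (a 1)"
  have "\<forall>x\<in>?A. \<not> ?lt x x \<and> (\<forall>y\<in>?A. (?lt x y \<or> x = y \<or> ?lt y x) \<and>
      (\<forall>z\<in>?A. ?lt x y \<and> ?lt y z \<longrightarrow> ?lt x z))"
  proof (intro ballI conjI impI)
    fix x y assume "x \<in> ?A" "y \<in> ?A"
    then show "?lt x y \<or> x = y \<or> ?lt y x"
      using numbering_less_iff[OF num] numbering_inj[OF num]
      by (cases "val x" "val y" rule: linorder_cases) auto
  qed (use numbering_less_iff[OF num] in auto)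
  then show ?thesis unfolding sat_order_fm Let_def .
qed

text \<open>
  The truth conditions of the recursive clauses (this one and the next two), with all quantifiers resolved,
  are the common starting point of the soundness and of the completeness proof.
\<close>
lemma sat_computes_fm_Comp:
  fixes f gs xs y
  defines "v \<equiv> fresh (y # xs)"
  defines "zs \<equiv> [v..<v + length gs]"
  shows "sat V E a (computes_fm (Comp f gs) xs y) \<longleftrightarrow>
    (\<exists>b. (\<forall>x. x \<notin> set zs \<longrightarrow> b x = a x) \<and> (\<forall>x\<in>set zs. b x \<in> nbhd V E (a 0)) \<and>
       (\<forall>i<length gs. sat V E b (computes_fm (gs ! i) xs (v + i))) \<and> sat V E b (computes_fm f zs y))"
proof -
  have "0 \<notin> set zs" using fresh_ge_2[of "y # xs"] by (auto simp: zs_def v_def)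
  then show ?thesis
    unfolding computes_fm.simps Let_def v_def[symmetric] zs_def[symmetric]
    by (auto simp: sat_foldr_ExA sat_foldr_Conj)
qed

lemma sat_computes_fm_PrimRec:
  fixes f g n ws y
  defines "w \<equiv> fresh (y # n # ws)"
  defines "i \<equiv> w + 1" and "z \<equiv> w + 2" and "j \<equiv> w + 3" and "u \<equiv> w + 4"
  assumes num: "numbering V E (a 0) (a 1) m val"
  shows "sat V E a (computes_fm (PrimRec f g) (n # ws) y) \<longleftrightarrow>
    (\<exists>W\<in>V. coded V E W (a n) (a y) \<and>
      (\<forall>k\<in>nbhd V E (a 0). \<forall>v\<in>nbhd V E (a 0). coded V E W k v \<longrightarrow>
        val k = 0 \<and> sat V E (a(w := W, i := k, z := v)) (computes_fm f ws z) \<or>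
        (\<exists>k'\<in>nbhd V E (a 0). \<exists>v'\<in>nbhd V E (a 0). val k = Suc (val k') \<and> coded V E W k' v' \<and>
          sat V E (a(w := W, i := k, z := v, j := k', u := v')) (computes_fm g (j # u # ws) z))))"
proof -
  have lt: "n < w" "y < w" using less_fresh[of _ "y # n # ws"] by (auto simp: w_def)
  have w2: "2 \<le> w" by (simp add: w_def fresh_ge_2)
  note d = i_def z_def j_def u_def
  have ne: "i \<noteq> 0" "z \<noteq> 0" "j \<noteq> 0" "u \<noteq> 0" "w \<noteq> 0" "i \<noteq> 1" "z \<noteq> 1" "j \<noteq> 1" "u \<noteq> 1" "w \<noteq> 1"
     "w \<noteq> i" "w \<noteq> z" "w \<noteq> j" "w \<noteq> u" "i \<noteq> z" "i \<noteq> j" "i \<noteq> u" "z \<noteq> j" "z \<noteq> u" "j \<noteq> u"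
     "n \<noteq> w" "y \<noteq> w"
    using w2 lt by (auto simp: d)
  have ge: "2 \<le> i" "2 \<le> z" "2 \<le> j" "2 \<le> u" using w2 by (simp_all add: d)
  have zero: "sat V E (a(w := W, i := k, z := v)) (zero_fm i) \<longleftrightarrow> val k = 0"
    if "k \<in> nbhd V E (a 0)" for W k v
    using that num ge ne by (subst sat_zero_fm[where m = m and val = val]) auto
  have succ: "sat V E (a(w := W, i := k, z := v, j := k', u := v')) (succ_fm j i) \<longleftrightarrow>
      val k = Suc (val k')"
    if "k \<in> nbhd V E (a 0)" "k' \<in> nbhd V E (a 0)" for W k v k' v'
    using that num ge ne by (subst sat_succ_fm[where m = m and val = val]) (auto simp: numbers_at_def)
  have "computes_fm (PrimRec f g) (n # ws) y = Ex w (Conj (coded_fm w n y)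
         (AllA i (AllA z (Imp (coded_fm w i z)
           (Disj (Conj (zero_fm i) (computes_fm f ws z))
             (ExA j (ExA u (Conj (succ_fm j i) (Conj (coded_fm w j u) (computes_fm g (j # u # ws) z))))))))))"
    by (simp only: computes_fm.simps list.case Let_def w_def[symmetric] d)
  moreover have "sat V E a \<dots> \<longleftrightarrow> (\<exists>W\<in>V. coded V E W (a n) (a y) \<and>
      (\<forall>k\<in>nbhd V E (a 0). \<forall>v\<in>nbhd V E (a 0). coded V E W k v \<longrightarrow>
        sat V E (a(w := W, i := k, z := v)) (zero_fm i) \<and>
        sat V E (a(w := W, i := k, z := v)) (computes_fm f ws z) \<or>
        (\<exists>k'\<in>nbhd V E (a 0). \<exists>v'\<in>nbhd V E (a 0).
          sat V E (a(w := W, i := k, z := v, j := k', u := v')) (succ_fm j i) \<and> coded V E W k' v' \<and>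
          sat V E (a(w := W, i := k, z := v, j := k', u := v')) (computes_fm g (j # u # ws) z))))"
    unfolding sat.simps(6)[of V E a w]
    by (simp only: sat_AllA[OF ne(1)] sat_AllA[OF ne(2)] sat_ExA[OF ne(3)] sat_ExA[OF ne(4)]
        sat.simps(3-5) sat_coded_fm imp_conv_disj fun_upd_same fun_upd_other ne ne[symmetric]
        not_False_eq_True)
  ultimately show ?thesis
    by (simp only: zero succ cong: ball_cong bex_cong conj_cong)
qed

lemma sat_computes_fm_Mu:
  fixes f xs y
  defines "v \<equiv> fresh (y # xs)"
  defines "i \<equiv> v + 1"
  assumes num: "numbering V E (a 0) (a 1) m val" and numbers_at: "numbers_at V E a (set (y # xs))"
  shows "sat V E a (computes_fm (Mu f) xs y) \<longleftrightarrow>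
    (\<exists>z\<in>nbhd V E (a 0). val z = 0 \<and> sat V E (a(v := z)) (computes_fm f (y # xs) v)) \<and>
    (\<forall>k\<in>nbhd V E (a 0). val k < val (a y) \<longrightarrow>
      (\<exists>u\<in>nbhd V E (a 0). 0 < val u \<and> sat V E (a(i := k, v := u)) (computes_fm f (i # xs) v)))"
proof -
  have v2: "2 \<le> v" by (simp add: v_def fresh_ge_2)
  have lt: "y < v" using less_fresh[of _ "y # xs"] by (auto simp: v_def)
  have ne: "i \<noteq> 0" "v \<noteq> 0" "i \<noteq> 1" "v \<noteq> 1" "i \<noteq> v" "y \<noteq> i" "y \<noteq> v" "2 \<le> i" "2 \<le> v"
    using v2 lt by (auto simp: i_def)
  have y: "a y \<in> nbhd V E (a 0)" using numbers_at by (simp add: numbers_at_def)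
  have zero: "sat V E (a(v := z)) (zero_fm v) \<longleftrightarrow> val z = 0" if "z \<in> nbhd V E (a 0)" for z
    using that num ne by (subst sat_zero_fm[where m = m and val = val]) auto
  have pos: "sat V E (a(i := k, v := z)) (zero_fm v) \<longleftrightarrow> val z = 0" if "z \<in> nbhd V E (a 0)" for z k
    using that num ne by (subst sat_zero_fm[where m = m and val = val]) auto
  have less: "sat V E (a(i := k)) (less_fm i y) \<longleftrightarrow> val k < val (a y)" if "k \<in> nbhd V E (a 0)" for k
    using that num ne y by (subst sat_less_fm[where m = m and val = val]) auto
  have "computes_fm (Mu f) xs y = Conj (ExA v (Conj (zero_fm v) (computes_fm f (y # xs) v)))
       (AllA i (Imp (less_fm i y) (ExA v (Conj (Neg (zero_fm v)) (computes_fm f (i # xs) v)))))"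
    by (simp only: computes_fm.simps Let_def v_def[symmetric] i_def)
  moreover have "sat V E a \<dots> \<longleftrightarrow>
    (\<exists>z\<in>nbhd V E (a 0). sat V E (a(v := z)) (zero_fm v) \<and> sat V E (a(v := z)) (computes_fm f (y # xs) v)) \<and>
    (\<forall>k\<in>nbhd V E (a 0). sat V E (a(i := k)) (less_fm i y) \<longrightarrow>
      (\<exists>u\<in>nbhd V E (a 0). \<not> sat V E (a(i := k, v := u)) (zero_fm v) \<and>
        sat V E (a(i := k, v := u)) (computes_fm f (i # xs) v)))"
    by (simp only: sat_AllA[OF ne(1)] sat_ExA[OF ne(2)] sat.simps(3-5) imp_conv_disj
        fun_upd_same fun_upd_other ne ne(1-7)[symmetric] not_False_eq_True)
  ultimately show ?thesis
    by (simp only: zero pos less neq0_conv cong: ball_cong bex_cong conj_cong)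
qed

section \<open>Soundness in every finite graph\<close>

text \<open>
  By induction on the term. For primitive recursion, correctness of a row is shown by
  induction on its number: justification of row \<open>i + 1\<close> appeals to a row with number \<open>i\<close>.
  For minimisation it matters that all numbers below \<open>y\<close> exist in the graph, because these form an initial segment.
\<close>
lemma computes_fm_sound:
  assumes "numbering V E (a 0) (a 1) m val" "numbers_at V E a (set (y # xs))" "sat V E a (computes_fm f xs y)"
  shows "rec_eval f (map (\<lambda>x. val (a x)) xs) (val (a y))"
  using assms
proof (induction f arbitrary: a xs y)
  case Zero
  then have "val (a y) = 0" using sat_zero_fm[OF Zero.prems(1), of y] by (simp add: numbers_at_def)
  then show ?case by (simp add: rec_eval.zero)
next
  case Succ
  from Succ.prems(3) obtain x where x: "xs = [x]"
    by (auto split: if_splits simp: length_Suc_conv)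
  with Succ.prems have "val (a y) = Suc (val (a x))"
    using sat_succ_fm[OF Succ.prems(1), of x y] by (simp add: numbers_at_def)
  with x show ?case by (simp add: rec_eval.succ)
next
  case (Proj i)
  then have "i < length xs" "a y = a (xs ! i)" by (auto split: if_splits)
  then show ?case using rec_eval.proj[of i "map (\<lambda>x. val (a x)) xs"] by simp
next
  case (Comp f gs)
  define v where "v = fresh (y # xs)"
  define zs where "zs = [v..<v + length gs]"
  obtain b where b: "\<And>x. x \<notin> set zs \<Longrightarrow> b x = a x" "\<And>x. x \<in> set zs \<Longrightarrow> b x \<in> nbhd V E (a 0)"
    "\<And>i. i < length gs \<Longrightarrow> sat V E b (computes_fm (gs ! i) xs (v + i))" "sat V E b (computes_fm f zs y)"
    using Comp.prems(3) unfolding sat_computes_fm_Comp v_def[symmetric] zs_def[symmetric] by blast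
  have v2: "2 \<le> v" by (simp add: v_def fresh_ge_2)
  have old: "b x = a x" if "x < v" for x using that b(1) by (auto simp: zs_def)
  have old': "b y = a y" "\<forall>x\<in>set xs. b x = a x" "b 0 = a 0" "b 1 = a 1"
    using old less_fresh[of _ "y # xs"] v2 by (auto simp: v_def[symmetric])
  have num: "numbering V E (b 0) (b 1) m val" using Comp.prems(1) old' by simp
  have numb: "numbers_at V E b (set (y # zs @ xs))"
    using Comp.prems(2) old' b(2) v2 by (auto simp: numbers_at_def zs_def)
  have "rec_eval f (map (\<lambda>x. val (b x)) zs) (val (b y))"
    using Comp.IH(1)[OF num _ b(4)] numb by (auto simp: numbers_at_def)
  moreover have "rec_eval (gs ! i) (map (\<lambda>x. val (a x)) xs) (val (b (v + i)))" if "i < length gs" for i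
  proof -
    have "gs ! i \<in> set gs" "v + i \<in> set zs" using that by (auto simp: zs_def)
    then have "rec_eval (gs ! i) (map (\<lambda>x. val (b x)) xs) (val (b (v + i)))"
      using Comp.IH(2)[OF _ num _ b(3)[OF that]] numb by (auto simp: numbers_at_def)
    then show ?thesis using old' by (simp cong: map_cong)
  qed
  then have "list_all2 (\<lambda>g z. rec_eval g (map (\<lambda>x. val (a x)) xs) z) gs (map (\<lambda>x. val (b x)) zs)"
    by (auto simp: list_all2_conv_all_nth zs_def)
  ultimately show ?case using old'(1) by (auto intro: rec_eval.comp)
next
  case (PrimRec f g)
  from PrimRec.prems(3) obtain n ws where xs: "xs = n # ws" by (cases xs) auto
  define w where "w = fresh (y # n # ws)"
  define i where "i = w + 1"
  define z where "z = w + 2"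
  define j where "j = w + 3"
  define u where "u = w + 4"
  note d = i_def z_def j_def u_def
  let ?A = "nbhd V E (a 0)"
  let ?ws = "map (\<lambda>x. val (a x)) ws"
  obtain W where W: "coded V E W (a n) (a y)"
    "\<And>k v. k \<in> ?A \<Longrightarrow> v \<in> ?A \<Longrightarrow> coded V E W k v \<Longrightarrow>
        val k = 0 \<and> sat V E (a(w := W, i := k, z := v)) (computes_fm f ws z) \<or>
        (\<exists>k'\<in>?A. \<exists>v'\<in>?A. val k = Suc (val k') \<and> coded V E W k' v' \<and>
          sat V E (a(w := W, i := k, z := v, j := k', u := v')) (computes_fm g (j # u # ws) z))"
    using PrimRec.prems(3)
    unfolding xs sat_computes_fm_PrimRec[where m = m and val = val, OF PrimRec.prems(1)] w_def[symmetric] d[symmetric]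
    by blast
  have w2: "2 \<le> w" by (simp add: w_def fresh_ge_2)
  have ws: "\<forall>x\<in>set ws. x < w" using less_fresh[of _ "y # n # ws"] by (auto simp: w_def)
  have numw: "\<forall>x\<in>set ws. 2 \<le> x \<and> a x \<in> ?A" "a n \<in> ?A" "a y \<in> ?A"
    using PrimRec.prems(2) by (auto simp: xs numbers_at_def)
  have "rec_eval (PrimRec f g) (val k # ?ws) (val v)" if "k \<in> ?A" "v \<in> ?A" "coded V E W k v" for k v
    using that
  proof (induction "val k" arbitrary: k v)
    case 0
    define b where "b = a(w := W, i := k, z := v)"
    have "sat V E b (computes_fm f ws z)" using W(2)[OF 0(2-4)] 0(1) by (auto simp: b_def)
    moreover have "numbering V E (b 0) (b 1) m val" using PrimRec.prems(1) w2 by (simp add: b_def d)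
    moreover have bws: "\<forall>x\<in>set ws. b x = a x" "b z = v" "b 0 = a 0" using ws w2 by (auto simp: b_def d)
    moreover have "numbers_at V E b (set (z # ws))" using numw w2 bws 0(3) by (auto simp: numbers_at_def z_def)
    ultimately have "rec_eval f (map (\<lambda>x. val (b x)) ws) (val (b z))" by (intro PrimRec.IH(1))
    then show ?case using 0(1)[symmetric] bws by (auto intro: rec_eval.prim_0 cong: map_cong)
  next
    case (Suc r)
    from W(2)[OF Suc(3-5)] Suc(2)[symmetric] obtain k' v' where
      kv: "k' \<in> ?A" "v' \<in> ?A" "r = val k'" "coded V E W k' v'"
        "sat V E (a(w := W, i := k, z := v, j := k', u := v')) (computes_fm g (j # u # ws) z)" by auto
    define b where "b = a(w := W, i := k, z := v, j := k', u := v')"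
    have "sat V E b (computes_fm g (j # u # ws) z)" using kv by (simp add: b_def)
    moreover have "numbering V E (b 0) (b 1) m val" using PrimRec.prems(1) w2 by (simp add: b_def d)
    moreover have bws: "\<forall>x\<in>set ws. b x = a x" "b z = v" "b j = k'" "b u = v'" "b 0 = a 0"
      using ws w2 by (auto simp: b_def d)
    moreover have "numbers_at V E b (set (z # j # u # ws))"
      using numw w2 bws Suc(4) kv by (auto simp: numbers_at_def d)
    ultimately have "rec_eval g (map (\<lambda>x. val (b x)) (j # u # ws)) (val (b z))" by (intro PrimRec.IH(2))
    then have "rec_eval g (r # val v' # ?ws) (val v)" using bws kv by (simp cong: map_cong)
    moreover have "rec_eval (PrimRec f g) (r # ?ws) (val v')" using Suc(1)[OF kv(3,1,2,4)] kv(3) by simp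
    ultimately show ?case using Suc(2)[symmetric] by (auto intro: rec_eval.prim_Suc)
  qed
  from this[OF numw(2,3) W(1)] show ?case by (simp add: xs)
next
  case (Mu f)
  define v where "v = fresh (y # xs)"
  define i where "i = v + 1"
  let ?A = "nbhd V E (a 0)"
  let ?xs = "map (\<lambda>x. val (a x)) xs"
  obtain z where z: "z \<in> ?A" "val z = 0" "sat V E (a(v := z)) (computes_fm f (y # xs) v)" and
    pos: "\<And>k. k \<in> ?A \<Longrightarrow> val k < val (a y) \<Longrightarrow>
      (\<exists>u\<in>?A. 0 < val u \<and> sat V E (a(i := k, v := u)) (computes_fm f (i # xs) v))"
    using Mu.prems(3) unfolding sat_computes_fm_Mu[where m = m and val = val, OF Mu.prems(1,2)]
      v_def[symmetric] i_def[symmetric] by blast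
  have v2: "2 \<le> v" by (simp add: v_def fresh_ge_2)
  have lt: "y < v" "\<forall>x\<in>set xs. x < v" using less_fresh[of _ "y # xs"] by (auto simp: v_def)
  have 1: "rec_eval f (val (a y) # ?xs) 0"
  proof -
    define b where "b = a(v := z)"
    have bs: "b 0 = a 0" "b 1 = a 1" "b v = z" "b y = a y" "\<forall>x\<in>set xs. b x = a x"
      using v2 lt by (auto simp: b_def)
    have "sat V E b (computes_fm f (y # xs) v)" using z(3) by (simp add: b_def)
    then have "rec_eval f (map (\<lambda>x. val (b x)) (y # xs)) (val (b v))"
      by (rule Mu.IH[rotated 2]) (use z(1) Mu.prems(1,2) v2 bs in \<open>auto simp: numbers_at_def\<close>)
    then show ?thesis using z(2) bs by (auto cong: map_cong)
  qed
  have 2: "\<exists>t>0. rec_eval f (r # ?xs) t" if "r < val (a y)" for r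
  proof -
    have "a y \<in> ?A" using Mu.prems(2) by (simp add: numbers_at_def)
    then have "r < m" using that numbering_bound[OF Mu.prems(1)] by (meson less_trans)
    then obtain k where k: "k \<in> ?A" "val k = r" using numbering_surj[OF Mu.prems(1)] by blast
    with pos that obtain u where u: "u \<in> ?A" "0 < val u" "sat V E (a(i := k, v := u)) (computes_fm f (i # xs) v)"
      by blast
    define b where "b = a(i := k, v := u)"
    have bs: "b 0 = a 0" "b 1 = a 1" "b v = u" "b i = k" "\<forall>x\<in>set xs. b x = a x"
      using v2 lt by (auto simp: b_def i_def)
    have "sat V E b (computes_fm f (i # xs) v)" using u(3) by (simp add: b_def)
    then have "rec_eval f (map (\<lambda>x. val (b x)) (i # xs)) (val (b v))"
      by (rule Mu.IH[rotated 2])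
        (use u(1) Mu.prems(1,2) v2 k(1) bs in \<open>auto simp: numbers_at_def i_def\<close>)
    then show ?thesis using u(2) k(2) bs by (auto cong: map_cong)
  qed
  show ?case using 1 2 by (rule rec_eval.mu)
qed

section \<open>Completeness in rich graphs\<close>

text \<open>
  Vertices are natural numbers here because a definition cannot quantify over their type, and the random graph has such vertices.
\<close>
definition holds_in_rich :: "recf \<Rightarrow> nat list \<Rightarrow> nat \<Rightarrow> nat \<Rightarrow> bool" where
  "holds_in_rich f xs y m \<longleftrightarrow> (\<forall>(V :: nat set) E a val us u.
     rich V E (a 0) (a 1) m val \<longrightarrow> numbers_at V E a (set (u # us)) \<longrightarrow>
     map (\<lambda>x. val (a x)) us = xs \<longrightarrow> val (a u) = y \<longrightarrow> sat V E a (computes_fm f us u))"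

lemma holds_in_richD:
  fixes V :: "nat set"
  assumes "holds_in_rich f xs y m" "rich V E (a 0) (a 1) m val" "numbers_at V E a (set (u # us))"
    "map (\<lambda>x. val (a x)) us = xs" "val (a u) = y"
  shows "sat V E a (computes_fm f us u)"
  using assms unfolding holds_in_rich_def by blast

lemma rich_numbering: "rich V E c s m val \<Longrightarrow> numbering V E c s m val"
  by (simp add: rich_def)

lemma rich_relation:
  assumes "rich V E c s m val" "R \<subseteq> {..<m} \<times> {..<m}"
  shows "\<exists>w\<in>V. \<forall>x\<in>nbhd V E c. \<forall>y\<in>nbhd V E c. coded V E w x y \<longleftrightarrow> (val x, val y) \<in> R"
  using assms by (simp add: rich_def)

text \<open>
  An evaluation involves only finitely many intermediate values. As soon as \<open>m\<close> exceeds them all, they are numbers of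
  a rich graph, and the tables of values are relations that the graph codes.
\<close>
lemma computes_fm_complete:
  "rec_eval f xs y \<Longrightarrow> \<forall>\<^sub>F m in sequentially. holds_in_rich f xs y m"
proof (induction f arbitrary: xs y)
  case Zero
  then have y: "y = 0" by (auto elim: rec_eval.cases)
  have "holds_in_rich Zero xs y m" for m
    unfolding holds_in_rich_def
  proof (intro allI impI)
    fix V :: "nat set" and E a val us u
    assume "rich V E (a 0) (a 1) m val" "numbers_at V E a (set (u # us))" "val (a u) = y"
    then show "sat V E a (computes_fm Zero us u)"
      using sat_zero_fm[of V E a m val u] y by (simp add: numbers_at_def rich_def)
  qed
  then show ?case by simp
next
  case Succ
  then obtain x where x: "xs = [x]" "y = Suc x" by (auto elim: rec_eval.cases)
  have "holds_in_rich Succ xs y m" for m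
    unfolding holds_in_rich_def
  proof (intro allI impI)
    fix V :: "nat set" and E a val us u
    assume *: "rich V E (a 0) (a 1) m val" "numbers_at V E a (set (u # us))"
      "map (\<lambda>x. val (a x)) us = xs" "val (a u) = y"
    from *(3) x obtain t where "us = [t]" "val (a t) = x" by auto
    then show "sat V E a (computes_fm Succ us u)"
      using sat_succ_fm[of V E a m val t u] x * by (simp add: numbers_at_def rich_def)
  qed
  then show ?case by simp
next
  case (Proj i)
  then have i: "i < length xs" "y = xs ! i" by (auto elim: rec_eval.cases)
  have "holds_in_rich (Proj i) xs y m" for m
    unfolding holds_in_rich_def
  proof (intro allI impI)
    fix V :: "nat set" and E a val us u
    assume *: "rich V E (a 0) (a 1) m val" "numbers_at V E a (set (u # us))"
      "map (\<lambda>x. val (a x)) us = xs" "val (a u) = y"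
    have l: "i < length us" using *(3) i by auto
    then have "val (a (us ! i)) = val (a u)" using i * by auto
    then have "a (us ! i) = a u"
      using numbering_inj[OF rich_numbering[OF *(1)], of "a (us ! i)" "a u"] *(2) l
      by (auto simp: numbers_at_def)
    then show "sat V E a (computes_fm (Proj i) us u)" using l by simp
  qed
  then show ?case by simp
next
  case (Comp f gs)
  from Comp.prems obtain ys where ys: "list_all2 (\<lambda>g y. rec_eval g xs y) gs ys" "rec_eval f ys y"
    by (auto elim: rec_eval.cases)
  have len: "length ys = length gs" using ys(1) by (simp add: list_all2_lengthD)
  have "\<forall>\<^sub>F m in sequentially. \<forall>i\<in>{..<length gs}. holds_in_rich (gs ! i) xs (ys ! i) m"
    using ys(1) Comp.IH(2) by (intro eventually_ball_finite) (auto simp: list_all2_conv_all_nth)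
  moreover have "\<forall>\<^sub>F m in sequentially. \<forall>i\<in>{..<length gs}. ys ! i < m"
    by (intro eventually_ball_finite) (auto intro: eventually_gt_at_top)
  moreover have "\<forall>\<^sub>F m in sequentially. holds_in_rich f ys y m" using Comp.IH(1) ys(2) .
  ultimately show ?case
  proof eventually_elim
    case (elim m)
    show ?case
      unfolding holds_in_rich_def
    proof (intro allI impI)
      fix V :: "nat set" and E a val us u
      assume *: "rich V E (a 0) (a 1) m val" "numbers_at V E a (set (u # us))"
        "map (\<lambda>x. val (a x)) us = xs" "val (a u) = y"
      let ?A = "nbhd V E (a 0)"
      define v where "v = fresh (u # us)"
      define zs where "zs = [v..<v + length gs]"
      have v2: "2 \<le> v" by (simp add: v_def fresh_ge_2)
      have lt: "u < v" "\<forall>x\<in>set us. x < v" using less_fresh[of _ "u # us"] by (auto simp: v_def)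
      have "\<forall>i<length gs. \<exists>t\<in>?A. val t = ys ! i"
        using numbering_surj[OF rich_numbering[OF *(1)]] elim(2) by auto
      then obtain t where t: "\<And>i. i < length gs \<Longrightarrow> t i \<in> ?A \<and> val (t i) = ys ! i" by metis
      define b where "b x = (if x \<in> set zs then t (x - v) else a x)" for x
      have old: "b x = a x" if "x < v" for x using that by (auto simp: b_def zs_def)
      have bs: "b 0 = a 0" "b 1 = a 1" "b u = a u" "\<forall>x\<in>set us. b x = a x"
        using old v2 lt by auto
      have bz: "b (v + i) = t i" if "i < length gs" for i using that by (simp add: b_def zs_def)
      have bz': "b x \<in> ?A" if "x \<in> set zs" for x using that t by (auto simp: b_def zs_def)
      have mapzs: "map (\<lambda>x. val (b x)) zs = ys"
        using t len by (auto intro!: nth_equalityI simp: zs_def bz)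
      have richb: "rich V E (b 0) (b 1) m val" using * bs by simp
      have numb: "numbers_at V E b (set (u # zs @ us))"
        using *(2) bs bz' v2 by (auto simp: numbers_at_def zs_def)
      have "sat V E b (computes_fm (gs ! i) us (v + i))" if "i < length gs" for i
      proof (rule holds_in_richD[OF _ richb])
        show "holds_in_rich (gs ! i) xs (ys ! i) m" using elim(1) that by auto
        show "numbers_at V E b (set ((v + i) # us))" using numb that by (auto simp: numbers_at_def zs_def)
        show "map (\<lambda>x. val (b x)) us = xs" using bs *(3) by (auto cong: map_cong)
        show "val (b (v + i)) = ys ! i" using bz t that by simp
      qed
      moreover have "sat V E b (computes_fm f zs u)"
        by (rule holds_in_richD[OF elim(3) richb _ mapzs]) (use numb *(4) bs in \<open>auto simp: numbers_at_def\<close>)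
      ultimately show "sat V E a (computes_fm (Comp f gs) us u)"
        unfolding sat_computes_fm_Comp v_def[symmetric] zs_def[symmetric]
        using bz' by (intro exI[of _ b]) (auto simp: b_def)
    qed
  qed
next
  case (PrimRec f g)
  from PrimRec.prems obtain n ws where xs: "xs = n # ws" by (auto elim: rec_eval.cases)
  from PrimRec.prems obtain Y where Y: "Y n = y" "rec_eval f ws (Y 0)"
    "\<And>i. i < n \<Longrightarrow> rec_eval g (i # Y i # ws) (Y (Suc i))"
    unfolding xs rec_eval_PrimRec_iff by blast
  have "\<forall>\<^sub>F m in sequentially. \<forall>i\<in>{..<n}. holds_in_rich g (i # Y i # ws) (Y (Suc i)) m"
    using PrimRec.IH(2)[OF Y(3)] by (intro eventually_ball_finite) auto
  moreover have "\<forall>\<^sub>F m in sequentially. \<forall>i\<in>{..n}. Y i < m"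
    by (intro eventually_ball_finite) (auto intro: eventually_gt_at_top)
  moreover have "\<forall>\<^sub>F m in sequentially. holds_in_rich f ws (Y 0) m" using PrimRec.IH(1) Y(2) .
  moreover have "\<forall>\<^sub>F m in sequentially. n < m" by (rule eventually_gt_at_top)
  ultimately show ?case
  proof eventually_elim
    case (elim m)
    show ?case
      unfolding holds_in_rich_def
    proof (intro allI impI)
      fix V :: "nat set" and E a val us u'
      assume *: "rich V E (a 0) (a 1) m val" "numbers_at V E a (set (u' # us))"
        "map (\<lambda>x. val (a x)) us = xs" "val (a u') = y"
      let ?A = "nbhd V E (a 0)"
      note num = rich_numbering[OF *(1)]
      from *(3) xs obtain t ts where us: "us = t # ts" "val (a t) = n"
        "map (\<lambda>x. val (a x)) ts = ws" by auto
      define w where "w = fresh (u' # t # ts)"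
      define i where "i = w + 1"
      define z where "z = w + 2"
      define j where "j = w + 3"
      define u where "u = w + 4"
      note d = i_def z_def j_def u_def
      have w2: "2 \<le> w" by (simp add: w_def fresh_ge_2)
      have lt: "\<forall>x\<in>set ts. x < w" using less_fresh[of _ "u' # t # ts"] by (auto simp: w_def)
      have A: "a t \<in> ?A" "a u' \<in> ?A" "\<forall>x\<in>set ts. 2 \<le> x \<and> a x \<in> ?A"
        using *(2) by (auto simp: numbers_at_def us)
\<comment> \<open>The vertex \<open>W\<close> codes the table of values.\<close>
      have "{(k, Y k) |k. k \<le> n} \<subseteq> {..<m} \<times> {..<m}" using elim by auto
      from rich_relation[OF *(1) this] obtain W where W0: "W \<in> V"
        "\<forall>k\<in>?A. \<forall>v\<in>?A. coded V E W k v \<longleftrightarrow> (val k, val v) \<in> {(k, Y k) |k. k \<le> n}" by blast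
      then have W: "W \<in> V"
        "\<And>k v. k \<in> ?A \<Longrightarrow> v \<in> ?A \<Longrightarrow> coded V E W k v \<longleftrightarrow> val k \<le> n \<and> val v = Y (val k)"
        by auto
      have "val k = 0 \<and> sat V E (a(w := W, i := k, z := v)) (computes_fm f ts z) \<or>
        (\<exists>k'\<in>?A. \<exists>v'\<in>?A. val k = Suc (val k') \<and> coded V E W k' v' \<and>
          sat V E (a(w := W, i := k, z := v, j := k', u := v')) (computes_fm g (j # u # ts) z))"
        if kv: "k \<in> ?A" "v \<in> ?A" "coded V E W k v" for k v
      proof (cases "val k")
        case 0
        define b where "b = a(w := W, i := k, z := v)"
        have bs: "\<forall>x\<in>set ts. b x = a x" "b z = v" "b 0 = a 0" "b 1 = a 1"
          using lt w2 by (auto simp: b_def d)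
        have "sat V E b (computes_fm f ts z)"
        proof (rule holds_in_richD[OF elim(3)])
          show "rich V E (b 0) (b 1) m val" using * bs by simp
          show "numbers_at V E b (set (z # ts))" using A kv bs w2 by (auto simp: numbers_at_def z_def)
          show "map (\<lambda>x. val (b x)) ts = ws" using us bs by (auto cong: map_cong)
          show "val (b z) = Y 0" using kv W(2)[of k v] 0 bs by simp
        qed
        then show ?thesis using 0 by (simp add: b_def)
      next
        case (Suc r)
        have r: "r < n" "val v = Y (Suc r)" using W(2)[OF kv(1,2)] kv(3) Suc by auto
        have "r < m" "Y r < m" using r elim by auto
        then obtain k' v' where kv': "k' \<in> ?A" "val k' = r" "v' \<in> ?A" "val v' = Y r"
          using numbering_surj[OF num] by metis
        define b where "b = a(w := W, i := k, z := v, j := k', u := v')"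
        have bs: "\<forall>x\<in>set ts. b x = a x" "b z = v" "b j = k'" "b u = v'" "b 0 = a 0" "b 1 = a 1"
          using lt w2 by (auto simp: b_def d)
        have "sat V E b (computes_fm g (j # u # ts) z)"
        proof (rule holds_in_richD)
          show "holds_in_rich g (r # Y r # ws) (Y (Suc r)) m" using elim(1) r by simp
          show "rich V E (b 0) (b 1) m val" using * bs by simp
          show "numbers_at V E b (set (z # j # u # ts))" using A kv kv' bs w2 by (auto simp: numbers_at_def d)
          show "map (\<lambda>x. val (b x)) (j # u # ts) = r # Y r # ws"
            using us bs kv' by (auto cong: map_cong)
          show "val (b z) = Y (Suc r)" using r bs by simp
        qed
        moreover have "coded V E W k' v'" using W(2)[OF kv'(1,3)] kv' r by simp
        ultimately show ?thesis using Suc kv' by (auto simp: b_def)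
      qed
      moreover have "coded V E W (a t) (a u')" using W(2)[OF A(1,2)] us(2) *(4) Y(1) by simp
      ultimately show "sat V E a (computes_fm (PrimRec f g) us u')"
        unfolding us(1) sat_computes_fm_PrimRec[where m = m and val = val, OF num]
          w_def[symmetric] d[symmetric]
        using W(1) by blast
    qed
  qed
next
  case (Mu f)
  from Mu.prems have y: "rec_eval f (y # xs) 0" "\<And>i. i < y \<Longrightarrow> \<exists>t>0. rec_eval f (i # xs) t"
    by (auto elim: rec_eval.cases)
  from y(2) obtain T where T: "\<And>i. i < y \<Longrightarrow> 0 < T i \<and> rec_eval f (i # xs) (T i)" by metis
  have "\<forall>\<^sub>F m in sequentially. \<forall>i\<in>{..<y}. holds_in_rich f (i # xs) (T i) m"
    using T Mu.IH by (intro eventually_ball_finite) auto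
  moreover have "\<forall>\<^sub>F m in sequentially. \<forall>i\<in>{..<y}. T i < m"
    by (intro eventually_ball_finite) (auto intro: eventually_gt_at_top)
  moreover have "\<forall>\<^sub>F m in sequentially. holds_in_rich f (y # xs) 0 m" using Mu.IH y(1) .
  moreover have "\<forall>\<^sub>F m in sequentially. 0 < m" by (rule eventually_gt_at_top)
  ultimately show ?case
  proof eventually_elim
    case (elim m)
    show ?case
      unfolding holds_in_rich_def
    proof (intro allI impI)
      fix V :: "nat set" and E a val us u'
      assume *: "rich V E (a 0) (a 1) m val" "numbers_at V E a (set (u' # us))"
        "map (\<lambda>x. val (a x)) us = xs" "val (a u') = y"
      let ?A = "nbhd V E (a 0)"
      note num = rich_numbering[OF *(1)]
      define v where "v = fresh (u' # us)"
      define i where "i = v + 1"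
      have v2: "2 \<le> v" by (simp add: v_def fresh_ge_2)
      have lt: "u' < v" "\<forall>x\<in>set us. x < v" using less_fresh[of _ "u' # us"] by (auto simp: v_def)
      have A: "\<forall>x\<in>set (u' # us). 2 \<le> x \<and> a x \<in> ?A" using *(2) by (auto simp: numbers_at_def)
      obtain z where z: "z \<in> ?A" "val z = 0" using numbering_surj[OF num elim(4)] by blast
      have "sat V E (a(v := z)) (computes_fm f (u' # us) v)"
      proof -
        define b where "b = a(v := z)"
        have bs: "\<forall>x\<in>set (u' # us). b x = a x" "b v = z" "b 0 = a 0" "b 1 = a 1"
          using lt v2 by (auto simp: b_def)
        have "sat V E b (computes_fm f (u' # us) v)"
          by (rule holds_in_richD[OF elim(3), where val = val])
            (use * A bs z v2 in \<open>auto simp: numbers_at_def cong: map_cong\<close>)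
        then show ?thesis by (simp add: b_def)
      qed
      moreover have "\<exists>u\<in>?A. 0 < val u \<and> sat V E (a(i := k, v := u)) (computes_fm f (i # us) v)"
        if k: "k \<in> ?A" "val k < val (a u')" for k
      proof -
        have ky: "val k < y" using k *(4) by simp
        then have "T (val k) < m" using elim by auto
        then obtain u where u: "u \<in> ?A" "val u = T (val k)" using numbering_surj[OF num] by blast
        define b where "b = a(i := k, v := u)"
        have bs: "\<forall>x\<in>set us. b x = a x" "b v = u" "b i = k" "b 0 = a 0" "b 1 = a 1"
          using lt v2 by (auto simp: b_def i_def)
        have "sat V E b (computes_fm f (i # us) v)"
        proof (rule holds_in_richD)
          show "holds_in_rich f (val k # xs) (T (val k)) m" using elim ky by simp
          show "rich V E (b 0) (b 1) m val" using * bs by simp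
          show "numbers_at V E b (set (v # i # us))" using A k u bs v2 by (auto simp: numbers_at_def i_def)
          show "map (\<lambda>x. val (b x)) (i # us) = val k # xs" using * bs by (auto cong: map_cong)
          show "val (b v) = T (val k)" using u bs by simp
        qed
        moreover have "0 < val u" using u(2) T[OF ky] by simp
        ultimately show ?thesis using u(1) unfolding b_def by blast
      qed
      ultimately show "sat V E a (computes_fm (Mu f) us u')"
        unfolding sat_computes_fm_Mu[where m = m and val = val, OF num *(2)]
          v_def[symmetric] i_def[symmetric]
        using z by blast
    qed
  qed
qed

section \<open>Sentences that force a large model\<close>

text \<open>
  For some choice of \<open>c\<close> and \<open>s\<close>, the number \<open>2 ^ r\<close> exists and \<open>f\<close> has a value among the numbers at each argument below it.
\<close>
definition size_fm :: "recf \<Rightarrow> nat \<Rightarrow> fm" where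
  "size_fm f r = Ex 0 (Ex 1 (Conj order_fm (ExA 2 (ExA 3 (Conj (Conj (zero_fm 2) (add_power_fm r 2 3))
     (AllA 4 (Imp (less_fm 4 3) (ExA 5 (computes_fm f [4] 5)))))))))"

lemma sentence_size_fm: "sentence (size_fm f r)"
proof -
  have "free_vars (size_fm f r) \<subseteq> {}"
    unfolding size_fm_def
    by (intro free_vars_subset_intros; (rule order.trans[OF free_vars_order_fm]
       order.trans[OF free_vars_zero_fm] order.trans[OF free_vars_add_power_fm]
       order.trans[OF free_vars_computes_fm])?) (auto simp: free_vars_coded_fm)
  then show ?thesis by (simp add: sentence_def)
qed

lemma qdepth_add_power_fm: "qdepth (add_power_fm r x y) = r + 3"
  by (induction r arbitrary: x y) (simp_all add: Let_def succ_fm_def coded_fm_def)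

text \<open>
  Only the definition of \<open>2 ^ r\<close> deepens with \<open>r\<close>, one quantifier for each doubling. A sentence of depth \<open>k\<close>
  can therefore afford \<open>r = k - D\<close>, where \<open>D\<close> depends on \<open>f\<close> only.
\<close>
lemma qdepth_size_fm: "qdepth (size_fm f r) \<le> r + qdepth (computes_fm f [4] 5) + 9"
  by (simp add: size_fm_def order_fm_def zero_fm_def qdepth_add_power_fm Let_def coded_fm_def)

lemma sat_size_fm_body:
  assumes num: "numbering V E (a 0) (a 1) m val"
  shows "sat V E a (ExA 2 (ExA 3 (Conj (Conj (zero_fm 2) (add_power_fm r 2 3))
     (AllA 4 (Imp (less_fm 4 3) (ExA 5 (computes_fm f [4] 5))))))) \<longleftrightarrow>
    (\<exists>o'\<in>nbhd V E (a 0). \<exists>b\<in>nbhd V E (a 0). val o' = 0 \<and> val b = 2 ^ r \<and>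
      (\<forall>i\<in>nbhd V E (a 0). val i < 2 ^ r \<longrightarrow>
        (\<exists>y\<in>nbhd V E (a 0). sat V E (a(2 := o', 3 := b, 4 := i, 5 := y)) (computes_fm f [4] 5))))"
proof -
  have ne: "(2::nat) \<noteq> 0" "(3::nat) \<noteq> 0" "(4::nat) \<noteq> 0" "(5::nat) \<noteq> 0"
    "(2::nat) \<noteq> 1" "(3::nat) \<noteq> 1" "(4::nat) \<noteq> 1" "(2::nat) \<noteq> 3" "(3::nat) \<noteq> 4" by simp_all
  have zero: "sat V E (a(2 := o', 3 := b)) (zero_fm 2) \<longleftrightarrow> val o' = 0"
    if "o' \<in> nbhd V E (a 0)" for o' b
    using that num by (subst sat_zero_fm[where m = m and val = val]) auto
  have power: "sat V E (a(2 := o', 3 := b)) (add_power_fm r 2 3) \<longleftrightarrow> val b = val o' + 2 ^ r"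
    if "o' \<in> nbhd V E (a 0)" "b \<in> nbhd V E (a 0)" for o' b
    using that num by (subst sat_add_power_fm[where m = m and val = val]) (auto simp: numbers_at_def)
  have less: "sat V E (a(2 := o', 3 := b, 4 := i)) (less_fm 4 3) \<longleftrightarrow> val i < val b"
    if "i \<in> nbhd V E (a 0)" "b \<in> nbhd V E (a 0)" for o' b i
    using that num by (subst sat_less_fm[where m = m and val = val]) auto
  have "sat V E a (ExA 2 (ExA 3 (Conj (Conj (zero_fm 2) (add_power_fm r 2 3))
     (AllA 4 (Imp (less_fm 4 3) (ExA 5 (computes_fm f [4] 5))))))) \<longleftrightarrow>
    (\<exists>o'\<in>nbhd V E (a 0). \<exists>b\<in>nbhd V E (a 0). (val o' = 0 \<and> val b = val o' + 2 ^ r) \<and>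
      (\<forall>i\<in>nbhd V E (a 0). val i < val b \<longrightarrow>
        (\<exists>y\<in>nbhd V E (a 0). sat V E (a(2 := o', 3 := b, 4 := i, 5 := y)) (computes_fm f [4] 5))))"
    by (simp only: sat_ExA[OF ne(1)] sat_ExA[OF ne(2)] sat_AllA[OF ne(3)] sat_ExA[OF ne(4)]
        sat.simps(3-5) imp_conv_disj[symmetric] fun_upd_same fun_upd_other ne ne[symmetric] not_False_eq_True
        zero power less cong: ball_cong bex_cong conj_cong)
  also have "\<dots> \<longleftrightarrow> (\<exists>o'\<in>nbhd V E (a 0). \<exists>b\<in>nbhd V E (a 0). val o' = 0 \<and> val b = 2 ^ r \<and>
      (\<forall>i\<in>nbhd V E (a 0). val i < 2 ^ r \<longrightarrow>
        (\<exists>y\<in>nbhd V E (a 0). sat V E (a(2 := o', 3 := b, 4 := i, 5 := y)) (computes_fm f [4] 5))))"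
    by (intro bex_cong refl) auto
  finally show ?thesis .
qed

text \<open>
  The value \<open>g n\<close> is itself a number of the graph, and the numbers are some of the vertices.
\<close>
lemma size_fm_sound:
  assumes "sat V E a (size_fm f r)" "finite V" and rec: "\<And>n. rec_eval f [n] (g n)" and "n < 2 ^ r"
  shows "g n < card V"
proof -
  obtain c s where "sat V E (a(0 := c, 1 := s)) order_fm" and
    body: "sat V E (a(0 := c, 1 := s)) (ExA 2 (ExA 3 (Conj (Conj (zero_fm 2) (add_power_fm r 2 3))
     (AllA 4 (Imp (less_fm 4 3) (ExA 5 (computes_fm f [4] 5)))))))"
    using assms(1) unfolding size_fm_def sat.simps(6)[of _ _ _ 0] sat.simps(6)[of _ _ _ 1]
      sat.simps(4)[of _ _ _ order_fm] by blast
  define b where "b = a(0 := c, 1 := s)"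
  define m where "m = card (nbhd V E (b 0))"
  obtain val where num: "numbering V E (b 0) (b 1) m val"
    using order_fm_numbering[of V E b] \<open>sat V E (a(0 := c, 1 := s)) order_fm\<close> assms(2)
    unfolding b_def m_def by blast
  obtain o' p where op: "o' \<in> nbhd V E (b 0)" "p \<in> nbhd V E (b 0)" "val p = 2 ^ r" and
    ex: "\<And>i. i \<in> nbhd V E (b 0) \<Longrightarrow> val i < 2 ^ r \<Longrightarrow>
        (\<exists>y\<in>nbhd V E (b 0). sat V E (b(2 := o', 3 := p, 4 := i, 5 := y)) (computes_fm f [4] 5))"
    using body unfolding b_def[symmetric] sat_size_fm_body[OF num] by blast
  have "n < m" using numbering_bound[OF num op(2)] op(3) assms(4) by simp
  then obtain i where i: "i \<in> nbhd V E (b 0)" "val i = n" using numbering_surj[OF num] by blast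
  with ex[of i] assms(4) obtain y where y: "y \<in> nbhd V E (b 0)"
    "sat V E (b(2 := o', 3 := p, 4 := i, 5 := y)) (computes_fm f [4] 5)" by auto
  define e where "e = b(2 := o', 3 := p, 4 := i, 5 := y)"
  have "rec_eval f (map (\<lambda>x. val (e x)) [4]) (val (e 5))"
    by (rule computes_fm_sound[of V E e m]) (use num y i in \<open>auto simp: numbers_at_def e_def\<close>)
  then have "rec_eval f [n] (val y)" using i by (simp add: e_def)
  then have "val y = g n" using rec rec_eval_deterministic by blast
  then have "g n < m" using numbering_bound[OF num y(1)] by simp
  also have "m \<le> card V" unfolding m_def using assms(2) by (intro card_mono) (auto simp: nbhd_def)
  finally show ?thesis .
qed

definition forced :: "nat \<Rightarrow> fm \<Rightarrow> bool" where
  "forced m \<phi> \<longleftrightarrow> (\<forall>(V :: nat set) E c s val a.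
     c \<in> V \<longrightarrow> s \<in> V \<longrightarrow> rich V E c s m val \<longrightarrow> sat V E a \<phi>)"

lemma size_fm_complete:
  assumes "\<And>n. \<exists>y. rec_eval f [n] y"
  shows "\<forall>\<^sub>F m in sequentially. forced m (size_fm f r)"
proof -
  obtain g where g: "\<And>n. rec_eval f [n] (g n)" using assms by metis
  have "\<forall>\<^sub>F m in sequentially. \<forall>n\<in>{..<2 ^ r}. holds_in_rich f [n] (g n) m"
    using computes_fm_complete[OF g] by (intro eventually_ball_finite) auto
  moreover have "\<forall>\<^sub>F m in sequentially. \<forall>n\<in>{..<2 ^ r}. g n < m"
    by (intro eventually_ball_finite) (auto intro: eventually_gt_at_top)
  moreover have "\<forall>\<^sub>F m in sequentially. 2 ^ r < m" by (rule eventually_gt_at_top)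
  ultimately show ?thesis
  proof eventually_elim
    case (elim m)
    show ?case
      unfolding forced_def
    proof (intro allI impI)
      fix V :: "nat set" and E c s val and a :: "nat \<Rightarrow> nat"
      assume cs: "c \<in> V" "s \<in> V" and rich: "rich V E c s m val"
      define b where "b = a(0 := c, 1 := s)"
      have b01: "b 0 = c" "b 1 = s" by (auto simp: b_def)
      have num: "numbering V E (b 0) (b 1) m val" using rich unfolding b01 rich_def by simp
      obtain o' p where op: "o' \<in> nbhd V E (b 0)" "val o' = 0" "p \<in> nbhd V E (b 0)" "val p = 2 ^ r"
        using numbering_surj[OF num, of 0] numbering_surj[OF num, of "2 ^ r"] elim(3) by auto
      have "\<exists>y\<in>nbhd V E (b 0). sat V E (b(2 := o', 3 := p, 4 := i, 5 := y)) (computes_fm f [4] 5)"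
        if i: "i \<in> nbhd V E (b 0)" "val i < 2 ^ r" for i
      proof -
        have "g (val i) < m" using elim(2) i by auto
        then obtain y where y: "y \<in> nbhd V E (b 0)" "val y = g (val i)"
          using numbering_surj[OF num] by blast
        define e where "e = b(2 := o', 3 := p, 4 := i, 5 := y)"
        have "rich V E (e 0) (e 1) m val" using rich by (simp add: e_def b_def)
        then have "sat V E e (computes_fm f [4] 5)"
          by (rule holds_in_richD[of f "[val i]" "g (val i)" m V E e val, rotated])
            (use elim(1) y i in \<open>auto simp: e_def numbers_at_def b01\<close>)
        then show ?thesis using y by (auto simp: e_def)
      qed
      then have "sat V E b (ExA 2 (ExA 3 (Conj (Conj (zero_fm 2) (add_power_fm r 2 3))
          (AllA 4 (Imp (less_fm 4 3) (ExA 5 (computes_fm f [4] 5)))))))"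
        unfolding sat_size_fm_body[OF num] using op by blast
      moreover have "sat V E b order_fm" using numbering_sat_order_fm[OF num] .
      ultimately show "sat V E a (size_fm f r)"
        unfolding size_fm_def sat.simps(6)[of _ _ _ 0] sat.simps(6)[of _ _ _ 1]
          sat.simps(4)[of _ _ _ order_fm] b_def
        using cs by blast
    qed
  qed
qed

section \<open>The second moment method for independent coordinates\<close>

lemma prob_Pi_pmf_agree:
  assumes "finite A" "S \<subseteq> A"
  shows "measure_pmf.prob (Pi_pmf A d q) {c. \<forall>e\<in>S. c e = \<sigma> e} = (\<Prod>e\<in>S. pmf (q e) (\<sigma> e))"
proof -
  have "measure_pmf.prob (Pi_pmf A d q) {c. \<forall>e\<in>S. c e = \<sigma> e} =
      measure_pmf.prob (Pi_pmf A d q) (Pi A (\<lambda>e. if e \<in> S then {\<sigma> e} else UNIV))"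
    by (rule arg_cong[where f = "measure_pmf.prob _"]) (use assms in \<open>auto simp: Pi_def\<close>)
  also have "\<dots> = (\<Prod>e\<in>A. if e \<in> S then pmf (q e) (\<sigma> e) else 1)"
    by (subst measure_Pi_pmf_Pi[OF assms(1)])
      (auto intro!: prod.cong simp: measure_pmf_single)
  also have "\<dots> = (\<Prod>e\<in>S. pmf (q e) (\<sigma> e))"
    using assms by (subst prod.mono_neutral_right[of A S]) auto
  finally show ?thesis .
qed

lemma prod_antimono_set:
  fixes f :: "'a \<Rightarrow> real"
  assumes "finite B" "A \<subseteq> B" "\<And>x. x \<in> B \<Longrightarrow> 0 \<le> f x \<and> f x \<le> 1"
  shows "prod f B \<le> prod f A"
proof -
  have "prod f B = prod f (B - A) * prod f A" by (rule prod.subset_diff[OF assms(2,1)])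
  also have "\<dots> \<le> 1 * prod f A"
    using assms by (intro mult_right_mono prod_le_1 prod_nonneg) auto
  finally show ?thesis by simp
qed

text \<open>
  With \<open>X\<close> the number of events that occur, this is Chebyshev's inequality for the deviation \<open>\<mu>\<close>: where no event occurs,
  \<open>(X - \<mu>)\<^sup>2 = \<mu>\<^sup>2\<close>.
\<close>
lemma second_moment:
  fixes M :: "'a pmf" and I :: "'j \<Rightarrow> 'a set"
  assumes "finite J"
  defines "\<mu> \<equiv> \<Sum>j\<in>J. measure_pmf.prob M (I j)"
  shows "measure_pmf.prob M (- (\<Union>j\<in>J. I j)) * \<mu>\<^sup>2 \<le>
    (\<Sum>i\<in>J. \<Sum>j\<in>J. measure_pmf.prob M (I i \<inter> I j)) - \<mu>\<^sup>2"
proof -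
  define X :: "'a \<Rightarrow> real" where "X x = (\<Sum>j\<in>J. indicator (I j) x)" for x
  have int [simp]: "integrable M (indicator B :: 'a \<Rightarrow> real)" for B
    by (rule measure_pmf.integrable_const_bound[where B = 1]) (auto simp: indicator_def)
  have XX: "(X x)\<^sup>2 = (\<Sum>i\<in>J. \<Sum>j\<in>J. indicator (I i \<inter> I j) x)" for x
    by (simp add: X_def power2_eq_square sum_product indicator_inter_arith)
  have iX: "integrable M X" unfolding X_def by (intro Bochner_Integration.integrable_sum int)
  have iXX: "integrable M (\<lambda>x. (X x)\<^sup>2)" unfolding XX by (intro Bochner_Integration.integrable_sum int)
  have EX: "measure_pmf.expectation M X = \<mu>"
    unfolding X_def \<mu>_def by (subst Bochner_Integration.integral_sum) auto
  have EXX: "measure_pmf.expectation M (\<lambda>x. (X x)\<^sup>2) =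
      (\<Sum>i\<in>J. \<Sum>j\<in>J. measure_pmf.prob M (I i \<inter> I j))"
    unfolding XX by (subst Bochner_Integration.integral_sum; (intro Bochner_Integration.integrable_sum int)?)+
      (simp del: Int_iff)
  have "measure_pmf.prob M (- (\<Union>j\<in>J. I j)) * \<mu>\<^sup>2 =
      measure_pmf.expectation M (\<lambda>x. indicator (- (\<Union>j\<in>J. I j)) x * \<mu>\<^sup>2)"
    by simp
  also have "\<dots> \<le> measure_pmf.expectation M (\<lambda>x. (X x)\<^sup>2 - 2 * \<mu> * X x + \<mu>\<^sup>2)"
  proof (rule integral_mono)
    fix x
    have "X x = 0" if "x \<in> - (\<Union>j\<in>J. I j)" using that by (simp add: X_def)
    moreover have "0 \<le> (X x - \<mu>)\<^sup>2" by simp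
    ultimately show "indicator (- (\<Union>j\<in>J. I j)) x * \<mu>\<^sup>2 \<le> (X x)\<^sup>2 - 2 * \<mu> * X x + \<mu>\<^sup>2"
      by (auto simp: indicator_def power2_diff algebra_simps)
  qed (use iX iXX in auto)
  also have "\<dots> = measure_pmf.expectation M (\<lambda>x. (X x)\<^sup>2) - 2 * \<mu> * measure_pmf.expectation M X + \<mu>\<^sup>2"
    using iX iXX by simp
  also have "\<dots> = (\<Sum>i\<in>J. \<Sum>j\<in>J. measure_pmf.prob M (I i \<inter> I j)) - \<mu>\<^sup>2"
    unfolding EX EXX by (simp add: power2_eq_square)
  finally show ?thesis .
qed

text \<open>
  Independent coordinates are compared with a fixed pattern \<open>\<sigma>\<close> on sets \<open>S j\<close>. Write \<open>P T\<close> for the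
  probability of agreement on \<open>T\<close>. Two events are correlated only through the overlap of their sets, with ratio
  \<open>P (S i \<union> S j) / (P (S i) P (S j)) = 1 / P (S i \<inter> S j)\<close>. For fixed \<open>i\<close> the overlaps are
  disjoint subsets of \<open>S i\<close>, so the product of these ratios is at most \<open>1 / P (S i)\<close>; and the sum of \<open>x - 1\<close>
  over numbers \<open>x \<ge> 1\<close> is at most their product. Hence the correlations increase the row sum for \<open>i\<close> by at most \<open>1\<close>,
  although a single ratio may be large.
\<close>
lemma prob_no_agreement:
  fixes S :: "'j \<Rightarrow> 'e set" and L :: real
  assumes "finite A" "finite J" "J \<noteq> {}" "\<And>j. j \<in> J \<Longrightarrow> S j \<subseteq> A"
    and two: "\<And>i j k. i \<in> J \<Longrightarrow> j \<in> J \<Longrightarrow> k \<in> J \<Longrightarrow> i \<noteq> j \<Longrightarrow> i \<noteq> k \<Longrightarrow> j \<noteq> k \<Longrightarrow>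
      S i \<inter> S j \<inter> S k = {}"
    and L: "0 < L" "\<And>j. j \<in> J \<Longrightarrow> L \<le> (\<Prod>e\<in>S j. pmf (q e) (\<sigma> e))"
  shows "measure_pmf.prob (Pi_pmf A d q) {c. \<not> (\<exists>j\<in>J. \<forall>e\<in>S j. c e = \<sigma> e)} \<le> 2 / (card J * L\<^sup>2)"
proof -
  define P where "P T = (\<Prod>e\<in>T. pmf (q e) (\<sigma> e))" for T
  define I where "I j = {c. \<forall>e\<in>S j. c e = \<sigma> e}" for j
  define \<mu> where "\<mu> = (\<Sum>j\<in>J. P (S j))"
  have fin: "finite (S j)" if "j \<in> J" for j using assms(1,4) that finite_subset by blast
  have prI: "measure_pmf.prob (Pi_pmf A d q) (I j) = P (S j)" if "j \<in> J" for j
    unfolding I_def P_def using prob_Pi_pmf_agree[OF assms(1) assms(4)[OF that]] .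
  have prII: "measure_pmf.prob (Pi_pmf A d q) (I i \<inter> I j) = P (S i \<union> S j)" if "i \<in> J" "j \<in> J" for i j
  proof -
    have "I i \<inter> I j = {c. \<forall>e\<in>S i \<union> S j. c e = \<sigma> e}" by (auto simp: I_def)
    then show ?thesis
      unfolding P_def using prob_Pi_pmf_agree[OF assms(1), of "S i \<union> S j"] assms(4) that by simp
  qed
  have P_le1: "P T \<le> 1" for T unfolding P_def by (intro prod_le_1) (auto simp: pmf_le_1)
  have Ppos: "0 < P (S j)" if "j \<in> J" for j using L that unfolding P_def by fastforce
  have pos: "0 < pmf (q e) (\<sigma> e)" if "e \<in> S j" "j \<in> J" for e j
    using Ppos[OF that(2)] that fin[OF that(2)] unfolding P_def
    by (metis pmf_nonneg order_le_less order_less_irrefl prod_zero)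
  have Ppos': "0 < P T" if "T \<subseteq> S j" "j \<in> J" for T j
    unfolding P_def using that pos by (intro prod_pos) blast
\<comment> \<open>The term \<open>j = i\<close> contributes \<open>P (S i)\<close>, the correlations at most \<open>1\<close>.\<close>
  have row: "(\<Sum>j\<in>J. P (S i \<union> S j)) \<le> P (S i) + 1 + P (S i) * \<mu>" if i: "i \<in> J" for i
  proof -
    have c: "0 < P (S i \<inter> S j)" for j using Ppos'[of "S i \<inter> S j" i] i by auto
    have eq: "P (S i \<union> S j) = P (S i) * P (S j) * (1 / P (S i \<inter> S j))" if "j \<in> J" for j
    proof -
      have "P (S i \<union> S j) * P (S i \<inter> S j) = P (S i) * P (S j)"
        unfolding P_def using fin i that by (intro prod.union_inter) auto
      then show ?thesis using c[of j] by (simp add: field_simps)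
    qed
\<comment> \<open>The factor \<open>P (S j) \<le> 1\<close> of the error term is dropped; what remains is summable without weights.\<close>
    have le: "P (S i \<union> S j) \<le> P (S i) * P (S j) + P (S i) * (1 / P (S i \<inter> S j) - 1)" if "j \<in> J" for j
    proof -
      have "1 \<le> 1 / P (S i \<inter> S j)" using c[of j] P_le1[of "S i \<inter> S j"] by (simp add: field_simps)
      moreover have "0 \<le> P (S i)" using Ppos[OF i] by simp
      moreover have "0 \<le> (1 - P (S j)) * P (S i) * (1 / P (S i \<inter> S j) - 1)"
        using calculation P_le1[of "S j"] by simp
      ultimately show ?thesis unfolding eq[OF that] by (simp add: algebra_simps)
    qed
    have "(\<Sum>j\<in>J - {i}. 1 / P (S i \<inter> S j) - 1) \<le> (\<Prod>j\<in>J - {i}. 1 + (1 / P (S i \<inter> S j) - 1))"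
      using c P_le1 by (intro sum_le_prod) (simp add: field_simps)
    also have "\<dots> = 1 / (\<Prod>j\<in>J - {i}. P (S i \<inter> S j))" by (simp add: prod_dividef)
    also have "(\<Prod>j\<in>J - {i}. P (S i \<inter> S j)) = P (\<Union>j\<in>J - {i}. S i \<inter> S j)"
      unfolding P_def using assms(2) fin i two[OF i]
      by (intro prod.UNION_disjoint[symmetric]) blast+
    also have "1 / P (\<Union>j\<in>J - {i}. S i \<inter> S j) \<le> 1 / P (S i)"
    proof -
      have "P (S i) \<le> P (\<Union>j\<in>J - {i}. S i \<inter> S j)"
        unfolding P_def using fin[OF i] by (intro prod_antimono_set) (auto simp: pmf_le_1)
      then show ?thesis using Ppos[OF i] by (simp add: frac_le)
    qed
    finally have s: "P (S i) * (\<Sum>j\<in>J - {i}. 1 / P (S i \<inter> S j) - 1) \<le> 1"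
      using Ppos[OF i] by (simp add: field_simps)
    have "(\<Sum>j\<in>J. P (S i \<union> S j)) = P (S i) + (\<Sum>j\<in>J - {i}. P (S i \<union> S j))"
      using assms(2) i by (subst sum.remove[of J i]) auto
    also have "(\<Sum>j\<in>J - {i}. P (S i \<union> S j)) \<le>
        (\<Sum>j\<in>J - {i}. P (S i) * P (S j) + P (S i) * (1 / P (S i \<inter> S j) - 1))"
      by (intro sum_mono le) auto
    also have "\<dots> = P (S i) * (\<Sum>j\<in>J - {i}. P (S j)) + P (S i) * (\<Sum>j\<in>J - {i}. 1 / P (S i \<inter> S j) - 1)"
      by (simp add: sum.distrib sum_distrib_left)
    also have "(\<Sum>j\<in>J - {i}. P (S j)) \<le> \<mu>"
      unfolding \<mu>_def using assms(2) Ppos by (intro sum_mono2) (auto intro: less_imp_le)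
    finally show ?thesis using s Ppos[OF i] by (simp add: mult_left_mono)
  qed
  let ?p = "measure_pmf.prob (Pi_pmf A d q) {c. \<not> (\<exists>j\<in>J. \<forall>e\<in>S j. c e = \<sigma> e)}"
  have "card J * L \<le> \<mu>" unfolding \<mu>_def using L sum_bounded_below[of J L] by (simp add: P_def)
  moreover have cJ: "0 < card J" using assms(2,3) by (simp add: card_gt_0_iff)
  ultimately have \<mu>: "0 < \<mu>" "(card J * L)\<^sup>2 \<le> \<mu>\<^sup>2"
    using L(1) by (smt (verit) mult_pos_pos of_nat_0_less_iff, intro power_mono, simp_all)
  have "?p * \<mu>\<^sup>2 \<le> (\<Sum>i\<in>J. \<Sum>j\<in>J. P (S i \<union> S j)) - \<mu>\<^sup>2"
  proof -
    have "{c. \<not> (\<exists>j\<in>J. \<forall>e\<in>S j. c e = \<sigma> e)} = - (\<Union>j\<in>J. I j)" by (auto simp: I_def)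
    moreover have "(\<Sum>j\<in>J. measure_pmf.prob (Pi_pmf A d q) (I j)) = \<mu>"
      unfolding \<mu>_def by (intro sum.cong refl prI)
    moreover have "(\<Sum>i\<in>J. \<Sum>j\<in>J. measure_pmf.prob (Pi_pmf A d q) (I i \<inter> I j)) =
        (\<Sum>i\<in>J. \<Sum>j\<in>J. P (S i \<union> S j))" by (intro sum.cong refl prII)
    ultimately show ?thesis using second_moment[OF assms(2), of "Pi_pmf A d q" I] by simp
  qed
  also have "(\<Sum>i\<in>J. \<Sum>j\<in>J. P (S i \<union> S j)) \<le> (\<Sum>i\<in>J. P (S i) + 1 + P (S i) * \<mu>)"
    by (intro sum_mono row)
  also have "\<dots> = \<mu> + card J + \<mu>\<^sup>2"
    by (simp add: sum.distrib \<mu>_def power2_eq_square flip: sum_distrib_right)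
  also have "\<mu> \<le> card J"
    unfolding \<mu>_def using P_le1 sum_bounded_above[of J "\<lambda>j. P (S j)" 1] by simp
  finally have p: "?p * \<mu>\<^sup>2 \<le> 2 * card J" by simp
  have "?p * (card J * L)\<^sup>2 \<le> ?p * \<mu>\<^sup>2" using \<mu>(2) by (intro mult_left_mono) auto
  with p have "?p * (card J * L)\<^sup>2 \<le> 2 * card J" by linarith
  then have "?p * (card J * L\<^sup>2) \<le> 2" using cJ by (simp add: power2_eq_square algebra_simps)
  then show ?thesis using cJ L(1) by (simp add: pos_le_divide_eq)
qed

section \<open>Isolated copies of finite graphs in the random graph\<close>

text \<open>
  For factors in the unit interval an overcount of the index set only decreases a product. This allows the edges at a
  block to be bounded vertex by vertex, ignoring that an edge inside the block is counted twice.
\<close>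
lemma prod_union_ge:
  fixes f :: "'a \<Rightarrow> real"
  assumes "finite A" "finite B" "\<And>x. x \<in> A \<union> B \<Longrightarrow> 0 \<le> f x \<and> f x \<le> 1"
  shows "prod f A * prod f B \<le> prod f (A \<union> B)"
proof -
  have "prod f A * prod f B = prod f (A \<union> B) * prod f (A \<inter> B)"
    by (rule prod.union_inter[OF assms(1,2), symmetric])
  also have "\<dots> \<le> prod f (A \<union> B) * 1"
    using assms(3) by (intro mult_left_mono prod_le_1 prod_nonneg) auto
  finally show ?thesis by simp
qed

lemma prod_UNION_ge:
  fixes f :: "'a \<Rightarrow> real"
  assumes "finite I" "\<And>i. i \<in> I \<Longrightarrow> finite (T i)"
    "\<And>i x. i \<in> I \<Longrightarrow> x \<in> T i \<Longrightarrow> 0 \<le> f x \<and> f x \<le> 1"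
  shows "(\<Prod>i\<in>I. prod f (T i)) \<le> prod f (\<Union>i\<in>I. T i)"
  using assms
proof (induction I rule: finite_induct)
  case empty
  then show ?case by simp
next
  case (insert i I)
  have "(\<Prod>i\<in>insert i I. prod f (T i)) = prod f (T i) * (\<Prod>i\<in>I. prod f (T i))"
    using insert.hyps by simp
  also have "\<dots> \<le> prod f (T i) * prod f (\<Union>i\<in>I. T i)"
    using insert by (intro mult_left_mono prod_nonneg) auto
  also have "\<dots> \<le> prod f (T i \<union> (\<Union>i\<in>I. T i))"
    using insert by (intro prod_union_ge) auto
  finally show ?case by simp
qed

text \<open>
  All edges at the image of \<open>K\<close> come from \<open>adj\<close>, so the image is also disconnected from the other vertices.
\<close>
definition isolated_copy ::
  "'k set \<Rightarrow> ('k \<Rightarrow> 'k \<Rightarrow> bool) \<Rightarrow> 'v set \<Rightarrow> 'v set set \<Rightarrow> ('k \<Rightarrow> 'v) \<Rightarrow> bool" where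
  "isolated_copy K adj V E \<iota> \<longleftrightarrow> inj_on \<iota> K \<and> \<iota> ` K \<subseteq> V \<and>
     (\<forall>x\<in>K. \<forall>v\<in>V. {\<iota> x, v} \<in> E \<longleftrightarrow> (\<exists>y\<in>K. v = \<iota> y \<and> adj x y))"

lemma finite_vertex_pairs: "finite (vertex_pairs n)"
  by (rule finite_subset[of _ "{1..n} \<times> {1..n}"]) (auto simp: vertex_pairs_def)

text \<open>
  The pairs to the right of a vertex realise each distance at most once, and so do the pairs to its left.
  Each vertex thus contributes at least the square of \<open>\<Prod>i\<le>n. 1 - p i\<close>.
\<close>
lemma prod_no_edge_ge:
  fixes p :: "nat \<Rightarrow> real"
  assumes p: "\<And>i. 1 \<le> i \<Longrightarrow> 0 < p i \<and> p i < 1"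
    and B: "B \<subseteq> {1..n}" "S \<subseteq> vertex_pairs n" "\<And>v w. (v, w) \<in> S \<Longrightarrow> v \<in> B \<or> w \<in> B"
  shows "(\<Prod>i=1..n. 1 - p i) ^ (2 * card B) \<le> (\<Prod>(v, w)\<in>S. 1 - p (w - v))"
proof -
  let ?f = "\<lambda>(v, w). 1 - p (w - v)" and ?q = "\<Prod>i=1..n. 1 - p i"
  define R where "R v = (\<lambda>d. (v, v + d)) ` {1..n - v}" for v :: nat
  define L where "L v = (\<lambda>d. (v - d, v)) ` {1..v - 1}" for v :: nat
  have finB: "finite B" using B(1) finite_subset by blast
  have f01: "0 \<le> ?f e \<and> ?f e \<le> 1" if "fst e < snd e" for e
    using p[of "snd e - fst e"] that by (cases e) (auto intro: less_imp_le)
  have q0: "0 \<le> ?q" using p by (intro prod_nonneg) (auto intro: less_imp_le)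
  have R: "?q \<le> prod ?f (R v)" for v
  proof -
    have "prod ?f (R v) = (\<Prod>d=1..n - v. 1 - p d)"
      unfolding R_def by (subst prod.reindex) (auto simp: inj_on_def)
    also have "\<dots> \<ge> ?q" using p by (intro prod_antimono_set) (auto intro: less_imp_le)
    finally show ?thesis .
  qed
  have L: "?q \<le> prod ?f (L v)" if "v \<in> B" for v
  proof -
    have "prod ?f (L v) = (\<Prod>d=1..v - 1. 1 - p (v - (v - d)))"
      unfolding L_def by (subst prod.reindex) (auto simp: inj_on_def)
    also have "\<dots> = (\<Prod>d=1..v - 1. 1 - p d)" by (intro prod.cong) auto
    also have "\<dots> \<ge> ?q"
    proof (rule prod_antimono_set)
      show "{1..v - 1} \<subseteq> {1..n}" using subsetD[OF B(1) that] by auto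
    qed (use p in \<open>auto intro: less_imp_le\<close>)
    finally show ?thesis .
  qed
  have lt: "fst e < snd e" if "e \<in> R v \<union> L v" for e v using that by (auto simp: R_def L_def)
  have fin: "finite (R v \<union> L v)" for v by (simp add: R_def L_def)
  have "?q ^ (2 * card B) = (\<Prod>v\<in>B. ?q * ?q)" by (simp add: power_mult power2_eq_square)
  also have "\<dots> \<le> (\<Prod>v\<in>B. prod ?f (R v \<union> L v))"
  proof (intro prod_mono conjI)
    fix v assume v: "v \<in> B"
    have "?q * ?q \<le> prod ?f (R v) * prod ?f (L v)"
      using R L[OF v] q0 by (intro mult_mono) (auto intro: order.trans)
    also have "\<dots> \<le> prod ?f (R v \<union> L v)"
      using fin[of v] f01 lt by (intro prod_union_ge) auto
    finally show "?q * ?q \<le> prod ?f (R v \<union> L v)" .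
  qed (use q0 in auto)
  also have "\<dots> \<le> prod ?f (\<Union>v\<in>B. R v \<union> L v)"
    using finB fin f01 lt by (intro prod_UNION_ge) auto
  also have "\<dots> \<le> prod ?f S"
  proof (rule prod_antimono_set)
    show "finite (\<Union>v\<in>B. R v \<union> L v)" using finB fin by auto
    show "0 \<le> ?f e \<and> ?f e \<le> 1" if "e \<in> (\<Union>v\<in>B. R v \<union> L v)" for e
      using that lt f01[of e] by blast
    show "S \<subseteq> (\<Union>v\<in>B. R v \<union> L v)"
    proof
      fix e assume e: "e \<in> S"
      obtain v w where vw: "e = (v, w)" by force
      have *: "1 \<le> v" "v < w" "w \<le> n" "v \<in> B \<or> w \<in> B"
        using e vw B(2,3) by (auto simp: vertex_pairs_def)
      have "e \<in> R v" unfolding R_def vw using * by (intro image_eqI[of _ _ "w - v"]) auto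
      moreover have "e \<in> L w" unfolding L_def vw using * by (intro image_eqI[of _ _ "w - v"]) auto
      ultimately show "e \<in> (\<Union>v\<in>B. R v \<union> L v)" using *(4) by blast
    qed
  qed
  finally show ?thesis .
qed

text \<open>
  Placing the copies on consecutive blocks of length \<open>card K\<close> makes one pattern \<open>\<sigma>\<close> serve all blocks: an edge
  is present if and only if its ends lie in the same block at positions that are adjacent in \<open>K\<close>.
  Block \<open>j\<close> carries an isolated copy as soon as the pattern is correct on the set \<open>S j\<close> of pairs that touch it, and
  no pair touches three blocks.
\<close>
lemma prob_isolated_copy_ge:
  fixes p :: "nat \<Rightarrow> real" and K :: "'k set"
  assumes p: "\<And>i. 1 \<le> i \<Longrightarrow> 0 < p i \<and> p i < 1"
    and K: "finite K" "K \<noteq> {}"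
    and sym: "\<And>x y. x \<in> K \<Longrightarrow> y \<in> K \<Longrightarrow> adj x y \<Longrightarrow> adj y x"
    and irr: "\<And>x. x \<in> K \<Longrightarrow> \<not> adj x x"
  obtains \<beta> where "0 < \<beta>" "\<And>n. card K \<le> n \<Longrightarrow>
    1 - 2 / (real (n div card K) * (\<beta> * (\<Prod>i=1..n. 1 - p i) ^ (2 * card K))\<^sup>2) \<le>
    measure_pmf.prob (random_graph n p) {E. \<exists>\<iota>. isolated_copy K adj {1..n} E \<iota>}"
proof -
  define h where "h = card K"
  have h: "0 < h" using K by (simp add: h_def card_gt_0_iff)
  obtain \<kappa> where \<kappa>: "bij_betw \<kappa> {0..<h} K"
    using ex_bij_betw_nat_finite[OF K(1)] unfolding h_def by blast
\<comment> \<open>A lower bound for the probability of each edge that a copy may need: it joins vertices at distance at most \<open>h\<close>.\<close>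
  define \<gamma> where "\<gamma> = Min (insert 1 (p ` {1..h}))"
  have "0 < \<gamma>" unfolding \<gamma>_def using p by (subst Min_gr_iff) auto
  moreover have "\<gamma> \<le> 1" unfolding \<gamma>_def by (rule Min_le) auto
  moreover have "\<gamma> \<le> p d" if "1 \<le> d" "d \<le> h" for d
    unfolding \<gamma>_def using that by (intro Min_le) auto
  ultimately have \<gamma>: "0 < \<gamma>" "\<gamma> \<le> 1" "\<And>d. 1 \<le> d \<Longrightarrow> d \<le> h \<Longrightarrow> \<gamma> \<le> p d" by auto
  define block where "block v = (v - 1) div h" for v
  define slot where "slot v = (v - 1) mod h" for v
  define \<sigma> where "\<sigma> = (\<lambda>(v, w). block v = block w \<and> adj (\<kappa> (slot v)) (\<kappa> (slot w)))"
  have slot: "slot v \<in> {0..<h}" for v using h by (simp add: slot_def)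
  show thesis
  proof (rule that[of "\<gamma> ^ (h * h)"])
    show "0 < \<gamma> ^ (h * h)" using \<gamma>(1) by simp
    fix n assume n: "card K \<le> n"
    let ?q = "\<Prod>i=1..n. 1 - p i"
    define J where "J = {..<n div h}"
    define B where "B j = {v \<in> {1..n}. block v = j}" for j
    define S where "S j = {(v, w) \<in> vertex_pairs n. v \<in> B j \<or> w \<in> B j}" for j
    define q where "q = (\<lambda>(v, w). bernoulli_pmf (p (w - v)))"
    have cardB: "finite (B j)" "card (B j) \<le> h" for j
    proof -
      have "B j \<subseteq> {j * h + 1..j * h + h}"
      proof
        fix v assume "v \<in> B j"
        then have v: "1 \<le> v" "(v - 1) div h = j" by (auto simp: B_def block_def)
        then have "v - 1 = j * h + (v - 1) mod h" by (metis div_mult_mod_eq)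
        with v(1) h mod_less_divisor[OF h, of "v - 1"] show "v \<in> {j * h + 1..j * h + h}" by auto
      qed
      from card_mono[OF _ this] show "card (B j) \<le> h" by simp
    qed (simp add: B_def)
    have q0: "0 \<le> ?q" "?q \<le> 1" using p by (intro prod_nonneg prod_le_1; auto intro: less_imp_le)+
    have lower: "\<gamma> ^ (h * h) * ?q ^ (2 * h) \<le> (\<Prod>e\<in>S j. pmf (q e) (\<sigma> e))" for j
    proof -
\<comment> \<open>Each factor is at least \<open>1 - p d\<close>, up to a constant \<open>\<gamma>\<close> for the at most \<open>h * h\<close> pairs inside the block.\<close>
      let ?k = "\<lambda>e. if e \<in> B j \<times> B j then \<gamma> else 1"
      have finS: "finite (S j)"
        by (rule finite_subset[OF _ finite_vertex_pairs[of n]]) (auto simp: S_def)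
      have "\<gamma> ^ (h * h) \<le> \<gamma> ^ card (B j \<times> B j)"
        using \<gamma> cardB by (intro power_decreasing) (auto simp: card_cartesian_product intro: mult_le_mono)
      also have "\<dots> = (\<Prod>e\<in>B j \<times> B j. \<gamma>)" by simp
      also have "\<dots> \<le> (\<Prod>e\<in>S j \<inter> B j \<times> B j. \<gamma>)"
        using \<gamma> cardB by (intro prod_antimono_set) auto
      also have "\<dots> = prod ?k (S j)" using finS by (rule prod.inter_restrict)
      finally have 1: "\<gamma> ^ (h * h) \<le> prod ?k (S j)" .
      have "?q ^ (2 * h) \<le> ?q ^ (2 * card (B j))"
        using q0 cardB(2)[of j] by (intro power_decreasing) auto
      also have "\<dots> \<le> (\<Prod>(v, w)\<in>S j. 1 - p (w - v))"
        using p by (rule prod_no_edge_ge) (auto simp: B_def S_def)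
      finally have 2: "?q ^ (2 * h) \<le> (\<Prod>(v, w)\<in>S j. 1 - p (w - v))" .
      have "\<gamma> ^ (h * h) * ?q ^ (2 * h) \<le> prod ?k (S j) * (\<Prod>(v, w)\<in>S j. 1 - p (w - v))"
        by (rule mult_mono[OF 1 2 prod_nonneg zero_le_power[OF q0(1)]]) (use \<gamma>(1) in auto)
      also have "\<dots> = (\<Prod>(v, w)\<in>S j. ?k (v, w) * (1 - p (w - v)))"
        by (simp add: case_prod_unfold mem_Times_iff flip: prod.distrib)
      also have "\<dots> \<le> (\<Prod>e\<in>S j. pmf (q e) (\<sigma> e))"
      proof (intro prod_mono)
        fix e assume e: "e \<in> S j"
        obtain v w where vw: "e = (v, w)" by force
        have *: "1 \<le> v" "v < w" "w \<le> n" "v \<in> B j \<or> w \<in> B j"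
          using e by (auto simp: S_def vw vertex_pairs_def)
        have pd: "0 < p (w - v)" "p (w - v) < 1" using p[of "w - v"] * by auto
        have "?k e * (1 - p (w - v)) \<le> pmf (q e) (\<sigma> e)"
        proof (cases "\<sigma> e")
          case True
          then have eq: "block v = block w" by (simp add: \<sigma>_def vw)
          with * have in_B: "e \<in> B j \<times> B j" by (auto simp: B_def vw)
          have "w - v < h"
          proof -
            have "v - 1 = block v * h + slot v" "w - 1 = block v * h + slot w"
              using eq by (metis block_def slot_def div_mult_mod_eq)+
            with * slot[of w] show ?thesis by simp
          qed
          then have "\<gamma> \<le> p (w - v)" using \<gamma>(3)[of "w - v"] * by simp
          moreover have "\<gamma> * (1 - p (w - v)) \<le> \<gamma> * 1" using pd \<gamma>(1) by (intro mult_left_mono) auto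
          ultimately show ?thesis using True in_B pd by (simp add: q_def vw)
        next
          case False
          have "?k e * (1 - p (w - v)) \<le> 1 * (1 - p (w - v))"
            using pd \<gamma> by (intro mult_right_mono) auto
          then show ?thesis using False pd by (simp add: q_def vw)
        qed
        moreover have "0 \<le> ?k e * (1 - p (w - v))" using pd \<gamma> by auto
        ultimately show "0 \<le> (case e of (v, w) \<Rightarrow> ?k (v, w) * (1 - p (w - v))) \<and>
            (case e of (v, w) \<Rightarrow> ?k (v, w) * (1 - p (w - v))) \<le> pmf (q e) (\<sigma> e)"
          by (simp add: vw)
      qed
      finally show ?thesis .
    qed
    have copy: "\<exists>\<iota>. isolated_copy K adj {1..n} {{v, w} |v w. (v, w) \<in> vertex_pairs n \<and> c (v, w)} \<iota>"
      if j: "j \<in> J" and c: "\<forall>e\<in>S j. c e = \<sigma> e" for j c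
    proof -
      define \<iota> where "\<iota> x = j * h + 1 + inv_into {0..<h} \<kappa> x" for x
      let ?E = "{{v, w} |v w. (v, w) \<in> vertex_pairs n \<and> c (v, w)}"
      have inv: "inv_into {0..<h} \<kappa> x < h" "\<kappa> (inv_into {0..<h} \<kappa> x) = x" if "x \<in> K" for x
        using that \<kappa> by (auto simp: bij_betw_def inv_into_into f_inv_into_f)
      have bl: "block (\<iota> x) = j" "\<kappa> (slot (\<iota> x)) = x" if "x \<in> K" for x
        using inv[OF that] by (auto simp: block_def slot_def \<iota>_def)
      have sl: "\<iota> (\<kappa> (slot v)) = v" "\<kappa> (slot v) \<in> K" if "block v = j" "1 \<le> v" for v
      proof -
        have "inv_into {0..<h} \<kappa> (\<kappa> (slot v)) = slot v"
          using \<kappa> slot[of v] by (auto simp: bij_betw_def)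
        moreover have "v - 1 = j * h + slot v" using that by (metis block_def slot_def div_mult_mod_eq)
        ultimately show "\<iota> (\<kappa> (slot v)) = v" using that by (simp add: \<iota>_def)
        show "\<kappa> (slot v) \<in> K" using \<kappa> slot[of v] by (auto simp: bij_betw_def)
      qed
      have range: "\<iota> x \<in> {1..n}" if "x \<in> K" for x
      proof -
        have "\<iota> x \<le> j * h + h" using inv(1)[OF that] by (simp add: \<iota>_def)
        also have "\<dots> = Suc j * h" by simp
        also have "\<dots> \<le> (n div h) * h" using j by (intro mult_le_mono) (auto simp: J_def)
        also have "\<dots> \<le> n" by simp
        finally show ?thesis by (simp add: \<iota>_def)
      qed
      have "inj_on \<iota> K" using bl(2) by (metis inj_onI)
      moreover have "\<iota> ` K \<subseteq> {1..n}" using range by blast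
      moreover have "{\<iota> x, v} \<in> ?E \<longleftrightarrow> (\<exists>y\<in>K. v = \<iota> y \<and> adj x y)" if x: "x \<in> K" and v: "v \<in> {1..n}" for x v
      proof -
        have rhs: "(\<exists>y\<in>K. v = \<iota> y \<and> adj x y) \<longleftrightarrow> block v = j \<and> adj x (\<kappa> (slot v))"
          using bl sl[of v] v by (metis atLeastAtMost_iff)
        have xB: "\<iota> x \<in> B j" using range[OF x] bl(1)[OF x] by (simp add: B_def)
        consider "\<iota> x < v" | "v < \<iota> x" | "v = \<iota> x" by linarith
        then show ?thesis
        proof cases
          case 1
          then have "{\<iota> x, v} \<in> ?E \<longleftrightarrow> c (\<iota> x, v)"
            using range[OF x] v by (auto simp: vertex_pairs_def doubleton_eq_iff)
          also have "\<dots> \<longleftrightarrow> \<sigma> (\<iota> x, v)"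
            using c 1 range[OF x] v xB by (auto simp: S_def vertex_pairs_def)
          also have "\<dots> \<longleftrightarrow> block v = j \<and> adj x (\<kappa> (slot v))" using bl[OF x] by (auto simp: \<sigma>_def)
          finally show ?thesis unfolding rhs .
        next
          case 2
          then have "{\<iota> x, v} \<in> ?E \<longleftrightarrow> c (v, \<iota> x)"
            using range[OF x] v by (auto simp: vertex_pairs_def doubleton_eq_iff)
          also have "\<dots> \<longleftrightarrow> \<sigma> (v, \<iota> x)"
            using c 2 range[OF x] v xB by (auto simp: S_def vertex_pairs_def)
          also have "\<dots> \<longleftrightarrow> block v = j \<and> adj (\<kappa> (slot v)) x" using bl[OF x] by (auto simp: \<sigma>_def)
          also have "\<dots> \<longleftrightarrow> block v = j \<and> adj x (\<kappa> (slot v))" using sym x sl(2)[of v] v by auto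
          finally show ?thesis unfolding rhs .
        next
          case 3
          then have "{\<iota> x, v} \<notin> ?E" by (auto simp: vertex_pairs_def doubleton_eq_iff)
          moreover have "\<not> (block v = j \<and> adj x (\<kappa> (slot v)))" using 3 bl[OF x] irr[OF x] by simp
          ultimately show ?thesis unfolding rhs by blast
        qed
      qed
      ultimately show ?thesis unfolding isolated_copy_def by blast
    qed
    let ?P = "Pi_pmf (vertex_pairs n) False q"
    have "measure_pmf.prob ?P {c. \<not> (\<exists>j\<in>J. \<forall>e\<in>S j. c e = \<sigma> e)} \<le>
        2 / (card J * (\<gamma> ^ (h * h) * ?q ^ (2 * h))\<^sup>2)"
    proof (rule prob_no_agreement)
      have "0 < n div h" using n h by (simp add: div_greater_zero_iff h_def)
      then show "J \<noteq> {}" unfolding J_def by blast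
      show "0 < \<gamma> ^ (h * h) * ?q ^ (2 * h)" using \<gamma>(1) p by (intro mult_pos_pos zero_less_power prod_pos) auto
      show "S i \<inter> S j \<inter> S k = {}" if "i \<noteq> j" "i \<noteq> k" "j \<noteq> k" for i j k
        using that by (auto simp: S_def B_def)
    qed (use lower finite_vertex_pairs in \<open>auto simp: J_def S_def\<close>)
    also have "measure_pmf.prob ?P {c. \<not> (\<exists>j\<in>J. \<forall>e\<in>S j. c e = \<sigma> e)} =
        1 - measure_pmf.prob ?P {c. \<exists>j\<in>J. \<forall>e\<in>S j. c e = \<sigma> e}"
      by (subst measure_pmf.prob_compl[symmetric]) (auto intro!: arg_cong[where f = "measure_pmf.prob _"])
    finally have "1 - 2 / (card J * (\<gamma> ^ (h * h) * ?q ^ (2 * h))\<^sup>2) \<le>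
        measure_pmf.prob ?P {c. \<exists>j\<in>J. \<forall>e\<in>S j. c e = \<sigma> e}" by simp
    also have "\<dots> \<le> measure_pmf.prob (random_graph n p) {E. \<exists>\<iota>. isolated_copy K adj {1..n} E \<iota>}"
      unfolding random_graph_def measure_map_pmf q_def[symmetric]
      by (rule measure_pmf.finite_measure_mono) (use copy in auto)
    finally show "1 - 2 / (real (n div card K) * (\<gamma> ^ (h * h) * ?q ^ (2 * card K))\<^sup>2) \<le>
        measure_pmf.prob (random_graph n p) {E. \<exists>\<iota>. isolated_copy K adj {1..n} E \<iota>}"
      by (simp add: J_def h_def)
  qed
qed

text \<open>
  By assumption \<open>ln q\<close> is eventually at least \<open>- ln n / (8 h)\<close>, where \<open>q\<close> is the product. Then
  \<open>q ^ (4 h) \<ge> 1 / sqrt n\<close>, which the number of blocks, of order \<open>n\<close>, outweighs.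
\<close>
lemma sparse_limit:
  fixes p :: "nat \<Rightarrow> real" and h :: nat
  assumes p: "\<And>i. 1 \<le> i \<Longrightarrow> 0 < p i \<and> p i < 1" and "0 < h" "0 < \<beta>"
    and lim: "(\<lambda>n. ln (\<Prod>i=1..n. 1 - p i) / ln (real n)) \<longlonglongrightarrow> 0"
  shows "(\<lambda>n. 2 / (real (n div h) * (\<beta> * (\<Prod>i=1..n. 1 - p i) ^ (2 * h))\<^sup>2)) \<longlonglongrightarrow> 0"
proof (rule tendsto_sandwich[OF _ _ tendsto_const])
  define q where "q n = (\<Prod>i=1..n. 1 - p i)" for n
  have q: "0 < q n" for n unfolding q_def using p by (intro prod_pos) auto
  have "\<forall>\<^sub>F n in sequentially. dist (ln (q n) / ln (real n)) 0 < 1 / (8 * real h)"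
    using lim assms(2) unfolding q_def by (intro tendstoD) auto
  moreover have "\<forall>\<^sub>F n in sequentially. 2 * h + 2 \<le> n" by (rule eventually_ge_at_top)
  ultimately show "\<forall>\<^sub>F n in sequentially.
      2 / (real (n div h) * (\<beta> * (\<Prod>i=1..n. 1 - p i) ^ (2 * h))\<^sup>2) \<le> 4 * real h / \<beta>\<^sup>2 / sqrt (real n)"
  proof eventually_elim
    case (elim n)
    have n: "2 \<le> n" "2 * h \<le> n" using elim(2) by auto
    then have ln: "0 < ln (real n)" by simp
    have "\<bar>ln (q n) / ln (real n)\<bar> < 1 / (8 * real h)" using elim(1) unfolding dist_real_def diff_0_right .
    then have "- (1 / (8 * real h)) < ln (q n) / ln (real n)" by linarith
    then have "- (1 / 2) * ln (real n) < 4 * real h * ln (q n)"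
      using ln assms(2) by (simp add: field_simps)
    then have "ln (real n powr (- (1 / 2))) < ln (q n ^ (4 * h))"
      using n q by (simp add: ln_powr ln_realpow)
    then have "real n powr (- (1 / 2)) < q n ^ (4 * h)"
      using n q by (subst (asm) ln_less_cancel_iff) auto
    then have 1: "1 / sqrt (real n) \<le> q n ^ (4 * h)"
      using n by (simp add: powr_minus powr_half_sqrt field_simps)
    have "real n \<le> 2 * real h * real (n div h)"
    proof -
      have "n = h * (n div h) + n mod h" by simp
      moreover have "n mod h < h" using assms(2) by simp
      ultimately have "n \<le> h * (n div h) + h" by linarith
      moreover have "h * 1 \<le> h * (n div h)"
        using n assms(2) by (intro mult_le_mono2) (simp add: Suc_leI div_greater_zero_iff)
      ultimately have "n \<le> 2 * h * (n div h)" by linarith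
      then have "real n \<le> real (2 * h * (n div h))" by (rule of_nat_mono)
      then show ?thesis by simp
    qed
    then have 2: "real n / (2 * real h) \<le> real (n div h)" using assms(2) by (simp add: field_simps)
    have "sqrt (real n) * \<beta>\<^sup>2 / (2 * real h) = real n / (2 * real h) * (\<beta>\<^sup>2 * (1 / sqrt (real n)))"
    proof -
      define s where "s = sqrt (real n)"
      have "0 < s" "real n = s * s" using n by (simp_all add: s_def)
      then show ?thesis unfolding s_def[symmetric] by (simp add: field_simps)
    qed
    also have "\<dots> \<le> real (n div h) * (\<beta>\<^sup>2 * q n ^ (4 * h))"
      using 1 2 assms(3) by (intro mult_mono) auto
    also have "\<beta>\<^sup>2 * q n ^ (4 * h) = (\<beta> * q n ^ (2 * h))\<^sup>2"
      by (simp add: power_mult_distrib flip: power_mult)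
    finally have "2 / (real (n div h) * (\<beta> * q n ^ (2 * h))\<^sup>2) \<le> 2 / (sqrt (real n) * \<beta>\<^sup>2 / (2 * real h))"
      using n assms(2,3) by (intro frac_le) auto
    also have "\<dots> = 4 * real h / \<beta>\<^sup>2 / sqrt (real n)" by simp
    finally show ?case unfolding q_def .
  qed
  show "(\<lambda>n. 4 * real h / \<beta>\<^sup>2 / sqrt (real n)) \<longlonglongrightarrow> 0"
    by (intro real_tendsto_divide_at_top[OF tendsto_const] filterlim_compose[OF sqrt_at_top]
        filterlim_real_sequentially)
qed (auto intro!: always_eventually)

lemma isolated_copy_tendsto_1:
  fixes p :: "nat \<Rightarrow> real" and K :: "'k set"
  assumes p: "\<And>i. 1 \<le> i \<Longrightarrow> 0 < p i \<and> p i < 1"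
    and lim: "(\<lambda>n. ln (\<Prod>i=1..n. 1 - p i) / ln (real n)) \<longlonglongrightarrow> 0"
    and K: "finite K" "K \<noteq> {}"
    and sym: "\<And>x y. x \<in> K \<Longrightarrow> y \<in> K \<Longrightarrow> adj x y \<Longrightarrow> adj y x"
    and irr: "\<And>x. x \<in> K \<Longrightarrow> \<not> adj x x"
  shows "(\<lambda>n. measure_pmf.prob (random_graph n p) {E. \<exists>\<iota>. isolated_copy K adj {1..n} E \<iota>}) \<longlonglongrightarrow> 1"
proof -
  obtain \<beta> where \<beta>: "0 < \<beta>" "\<And>n. card K \<le> n \<Longrightarrow>
    1 - 2 / (real (n div card K) * (\<beta> * (\<Prod>i=1..n. 1 - p i) ^ (2 * card K))\<^sup>2) \<le>
    measure_pmf.prob (random_graph n p) {E. \<exists>\<iota>. isolated_copy K adj {1..n} E \<iota>}"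
    using prob_isolated_copy_ge[where p = p and adj = adj, OF p K sym irr] by blast
  have "0 < card K" using K by (simp add: card_gt_0_iff)
  then have "(\<lambda>n. 1 - 2 / (real (n div card K) * (\<beta> * (\<Prod>i=1..n. 1 - p i) ^ (2 * card K))\<^sup>2)) \<longlonglongrightarrow> 1 - 0"
    using sparse_limit[where p = p, OF p _ \<beta>(1) lim] by (intro tendsto_diff tendsto_const)
  then have lb: "(\<lambda>n. 1 - 2 / (real (n div card K) * (\<beta> * (\<Prod>i=1..n. 1 - p i) ^ (2 * card K))\<^sup>2)) \<longlonglongrightarrow> 1"
    by simp
  show ?thesis
  proof (rule tendsto_sandwich[OF _ _ lb tendsto_const])
    show "\<forall>\<^sub>F n in sequentially. 1 - 2 / (real (n div card K) * (\<beta> * (\<Prod>i=1..n. 1 - p i) ^ (2 * card K))\<^sup>2) \<le>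
      measure_pmf.prob (random_graph n p) {E. \<exists>\<iota>. isolated_copy K adj {1..n} E \<iota>}"
      using eventually_ge_at_top[of "card K"] by eventually_elim (rule \<beta>(2))
  qed (auto intro!: always_eventually)
qed

section \<open>A finite graph that codes all relations on an initial segment\<close>

text \<open>
  The vertices \<open>Fst a b\<close> and \<open>Snd a b\<close> represent the ordered pair \<open>(a, b)\<close> as the vertices
  \<open>p\<close> and \<open>q\<close> in the definition of \<open>coded\<close>.
\<close>
datatype gadget = Centre | Num nat | Fst nat nat | Snd nat nat | Rel "(nat \<times> nat) set"

fun gadget_arc :: "gadget \<Rightarrow> gadget \<Rightarrow> bool" where
  "gadget_arc Centre (Num a) = True"
| "gadget_arc (Num a) (Fst a' b') = (a = a')"
| "gadget_arc (Fst a b) (Snd a' b') = (a = a' \<and> b = b')"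
| "gadget_arc (Snd a b) (Num b') = (b = b')"
| "gadget_arc (Rel R) (Fst a b) = ((a, b) \<in> R)"
| "gadget_arc _ _ = False"

definition gadget_adj :: "gadget \<Rightarrow> gadget \<Rightarrow> bool" where
  "gadget_adj x y \<longleftrightarrow> gadget_arc x y \<or> gadget_arc y x"

definition gadget_vertices :: "nat \<Rightarrow> gadget set" where
  "gadget_vertices m = insert Centre (Num ` {..<m}) \<union> (\<lambda>(a, b). Fst a b) ` ({..<m} \<times> {..<m}) \<union>
     (\<lambda>(a, b). Snd a b) ` ({..<m} \<times> {..<m}) \<union> Rel ` Pow ({..<m} \<times> {..<m})"

lemma gadget_adj_sym: "gadget_adj x y \<Longrightarrow> gadget_adj y x"
  by (auto simp: gadget_adj_def)

lemma gadget_adj_irrefl: "\<not> gadget_adj x x"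
  by (cases x) (auto simp: gadget_adj_def)

lemma finite_gadget_vertices: "finite (gadget_vertices m)"
  by (auto simp: gadget_vertices_def)

lemma gadget_vertices_iff:
  "Centre \<in> gadget_vertices m"
  "Num a \<in> gadget_vertices m \<longleftrightarrow> a < m"
  "Fst a b \<in> gadget_vertices m \<longleftrightarrow> a < m \<and> b < m"
  "Snd a b \<in> gadget_vertices m \<longleftrightarrow> a < m \<and> b < m"
  "Rel R \<in> gadget_vertices m \<longleftrightarrow> R \<subseteq> {..<m} \<times> {..<m}"
  by (auto simp: gadget_vertices_def)

text \<open>
  In an isolated copy the paths in the definition of \<open>coded\<close> cannot leave the gadget, so a vertex
  \<open>Rel R\<close> codes exactly \<open>R\<close>; in particular the order itself is coded by one of these vertices.
\<close>
lemma isolated_gadget_rich: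
  assumes copy: "isolated_copy (gadget_vertices m) gadget_adj V E \<iota>"
  shows "rich V E (\<iota> Centre) (\<iota> (Rel {(a, b). a < b \<and> b < m})) m
    (\<lambda>v. case inv_into (gadget_vertices m) \<iota> v of Num a \<Rightarrow> a | _ \<Rightarrow> 0)"
proof -
  let ?K = "gadget_vertices m"
  define val where "val v = (case inv_into ?K \<iota> v of Num a \<Rightarrow> a | _ \<Rightarrow> 0)" for v
  have inj: "inj_on \<iota> ?K" and inV: "\<And>x. x \<in> ?K \<Longrightarrow> \<iota> x \<in> V"
    and edge: "\<And>x v. x \<in> ?K \<Longrightarrow> v \<in> V \<Longrightarrow> {\<iota> x, v} \<in> E \<longleftrightarrow> (\<exists>y\<in>?K. v = \<iota> y \<and> gadget_adj x y)"
    using copy by (auto simp: isolated_copy_def)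
  have edge': "{\<iota> x, \<iota> y} \<in> E \<longleftrightarrow> gadget_adj x y" if "x \<in> ?K" "y \<in> ?K" for x y
    using edge[OF that(1) inV[OF that(2)]] that inj by (auto dest: inj_onD)
  note mem = gadget_vertices_iff
  have cases: "gadget_adj Centre y \<longleftrightarrow> (\<exists>a. y = Num a)" for y by (cases y) (auto simp: gadget_adj_def)
  have casesR: "gadget_adj (Rel R) y \<longleftrightarrow> (\<exists>a b. y = Fst a b \<and> (a, b) \<in> R)" for y R
    by (cases y) (auto simp: gadget_adj_def)
  have nb: "nbhd V E (\<iota> Centre) = \<iota> ` Num ` {..<m}"
    using edge[OF mem(1)] mem(2) inV by (auto simp: nbhd_def cases)
  have val: "val (\<iota> (Num a)) = a" if "a < m" for a
    using that inj mem(2) by (simp add: val_def)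
  have coded: "coded V E (\<iota> (Rel R)) (\<iota> (Num a)) (\<iota> (Num b)) \<longleftrightarrow> (a, b) \<in> R"
    if R: "R \<subseteq> {..<m} \<times> {..<m}" and ab: "a < m" "b < m" for R a b
  proof
    assume "(a, b) \<in> R"
    then show "coded V E (\<iota> (Rel R)) (\<iota> (Num a)) (\<iota> (Num b))"
      unfolding coded_def using R ab
      by (intro bexI[of _ "\<iota> (Fst a b)"] bexI[of _ "\<iota> (Snd a b)"] inV)
        (auto simp: edge' mem gadget_adj_def)
  next
    assume "coded V E (\<iota> (Rel R)) (\<iota> (Num a)) (\<iota> (Num b))"
    then obtain v w where v: "v \<in> V" "w \<in> V" "{\<iota> (Rel R), v} \<in> E" "{v, \<iota> (Num a)} \<in> E"
      "{v, w} \<in> E" "{w, \<iota> (Num b)} \<in> E" unfolding coded_def by blast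
    from v(1,3) R obtain a' b' where ab': "v = \<iota> (Fst a' b')" "(a', b') \<in> R" "Fst a' b' \<in> ?K"
      using edge[of "Rel R" v] mem(5)[of R] by (auto simp: casesR)
    from v(2,5) ab' obtain y where y: "w = \<iota> y" "y \<in> ?K" "gadget_adj (Fst a' b') y"
      using edge[of "Fst a' b'" w] by auto
    have "gadget_adj (Fst a' b') (Num a)" using v(4) ab' ab mem(2) by (simp add: edge')
    then have "a' = a" by (simp add: gadget_adj_def)
    moreover have "gadget_adj y (Num b)" using v(6) y ab mem(2) by (simp add: edge')
    then have "b' = b" using y(3) by (cases y) (auto simp: gadget_adj_def)
    ultimately show "(a, b) \<in> R" using ab' by simp
  qed
  have s: "{(a, b). a < b \<and> b < m} \<subseteq> {..<m} \<times> {..<m}" by auto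
  have bij: "bij_betw val (nbhd V E (\<iota> Centre)) {..<m}"
  proof -
    have "inj_on val (nbhd V E (\<iota> Centre))" unfolding nb by (auto simp: inj_on_def val)
    moreover have "val ` nbhd V E (\<iota> Centre) = {..<m}" unfolding nb image_image by (simp add: val)
    ultimately show ?thesis by (simp add: bij_betw_def)
  qed
  have "numbering V E (\<iota> Centre) (\<iota> (Rel {(a, b). a < b \<and> b < m})) m val"
    unfolding numbering_def using bij by (auto simp: nb coded[OF s] val)
  moreover have "\<exists>w\<in>V. \<forall>x\<in>nbhd V E (\<iota> Centre). \<forall>y\<in>nbhd V E (\<iota> Centre).
      coded V E w x y \<longleftrightarrow> (val x, val y) \<in> R" if "R \<subseteq> {..<m} \<times> {..<m}" for R
    using that mem(5) by (intro bexI[of _ "\<iota> (Rel R)"] inV) (auto simp: nb coded[OF that] val)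
  ultimately show ?thesis unfolding rich_def val_def by blast
qed

section \<open>The sequence of sentences\<close>

instance recf :: countable
  by countable_datatype

text \<open>
  A sentence that is true in every nonempty graph and brings a conjunction up to depth \<open>k\<close>.
\<close>
fun pad_fm :: "nat \<Rightarrow> fm" where
  "pad_fm 0 = Eq 0 0"
| "pad_fm (Suc k) = Ex 0 (pad_fm k)"

lemma free_vars_pad_fm: "free_vars (pad_fm k) \<subseteq> {0}" "1 \<le> k \<Longrightarrow> free_vars (pad_fm k) = {}"
proof -
  show *: "free_vars (pad_fm k) \<subseteq> {0}" for k by (induction k) auto
  show "1 \<le> k \<Longrightarrow> free_vars (pad_fm k) = {}" using *[of "k - 1"] by (cases k) auto
qed

lemma qdepth_pad_fm: "qdepth (pad_fm k) = k"
  by (induction k) auto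

lemma sat_pad_fm: "V \<noteq> {} \<Longrightarrow> sat V E a (pad_fm k)"
  by (induction k arbitrary: a) auto

lemma qdepth_foldr_Conj:
  "\<forall>\<psi>\<in>set \<psi>s. qdepth \<psi> \<le> qdepth \<phi> \<Longrightarrow> qdepth (foldr Conj \<psi>s \<phi>) = qdepth \<phi>"
  by (induction \<psi>s) auto

text \<open>
  The terms are enumerated by \<open>to_nat\<close>; the bounds on \<open>to_nat f\<close> and \<open>r\<close> keep the set finite, and a fixed term
  satisfies the first one for all large \<open>k\<close>.
\<close>
definition demands :: "nat \<Rightarrow> (recf \<times> nat) set" where
  "demands k = {(f, r). to_nat f < k \<and> r < k \<and> (\<forall>n. \<exists>y. rec_eval f [n] y) \<and> qdepth (size_fm f r) \<le> k}"

lemma finite_demands: "finite (demands k)"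
proof (rule finite_subset)
  show "demands k \<subseteq> from_nat ` {..<k} \<times> {..<k}"
    by (auto simp: demands_def image_iff) (metis from_nat_to_nat lessThan_iff)
qed auto

definition fast_sentence :: "nat \<Rightarrow> fm" where
  "fast_sentence k = foldr Conj (SOME \<psi>s. set \<psi>s = (\<lambda>(f, r). size_fm f r) ` demands k) (pad_fm k)"

lemma set_fast_sentence:
  "set (SOME \<psi>s. set \<psi>s = (\<lambda>(f, r). size_fm f r) ` demands k) = (\<lambda>(f, r). size_fm f r) ` demands k"
  using someI_ex[OF finite_list[OF finite_imageI[OF finite_demands]]] .

lemma sentence_fast_sentence: "1 \<le> k \<Longrightarrow> sentence (fast_sentence k)"
  using sentence_size_fm by (auto simp: sentence_def fast_sentence_def free_vars_foldr_Conj set_fast_sentence free_vars_pad_fm)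

lemma qdepth_fast_sentence: "qdepth (fast_sentence k) = k"
proof -
  have "\<forall>\<psi>\<in>(\<lambda>(f, r). size_fm f r) ` demands k. qdepth \<psi> \<le> qdepth (pad_fm k)"
    by (auto simp: demands_def qdepth_pad_fm)
  then show ?thesis
    unfolding fast_sentence_def using qdepth_foldr_Conj qdepth_pad_fm by (simp add: set_fast_sentence)
qed

lemma sat_fast_sentence:
  "V \<noteq> {} \<Longrightarrow> sat V E a (fast_sentence k) \<longleftrightarrow> (\<forall>(f, r)\<in>demands k. sat V E a (size_fm f r))"
  by (auto simp: fast_sentence_def sat_foldr_Conj set_fast_sentence sat_pad_fm)

lemma Prob_fast_sentence_tendsto_1:
  fixes p :: "nat \<Rightarrow> real"
  assumes p: "\<And>i. 1 \<le> i \<Longrightarrow> 0 < p i \<and> p i < 1"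
    and lim: "(\<lambda>n. ln (\<Prod>i=1..n. 1 - p i) / ln (real n)) \<longlonglongrightarrow> 0"
  shows "(\<lambda>n. Prob n p (fast_sentence k)) \<longlonglongrightarrow> 1"
proof -
  have "\<forall>\<^sub>F m in sequentially. \<forall>x\<in>demands k. forced m (size_fm (fst x) (snd x))"
    by (intro eventually_ball_finite finite_demands) (auto simp: demands_def intro: size_fm_complete)
  from eventually_happens'[OF sequentially_bot this]
  obtain m where m: "\<And>f r. (f, r) \<in> demands k \<Longrightarrow> forced m (size_fm f r)" by force
  let ?K = "gadget_vertices m"
  have lb: "(\<lambda>n. measure_pmf.prob (random_graph n p) {E. \<exists>\<iota>. isolated_copy ?K gadget_adj {1..n} E \<iota>}) \<longlonglongrightarrow> 1"
    using p lim by (rule isolated_copy_tendsto_1)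
      (use gadget_adj_sym gadget_adj_irrefl finite_gadget_vertices in \<open>auto simp: gadget_vertices_def\<close>)
  have "measure_pmf.prob (random_graph n p) {E. \<exists>\<iota>. isolated_copy ?K gadget_adj {1..n} E \<iota>} \<le> Prob n p (fast_sentence k)" for n
    unfolding Prob_def
  proof (rule measure_pmf.finite_measure_mono)
    show "{E. \<exists>\<iota>. isolated_copy ?K gadget_adj {1..n} E \<iota>} \<subseteq> {E. models {1..n} E (fast_sentence k)}"
    proof safe
      fix E \<iota> assume copy: "isolated_copy ?K gadget_adj {1..n} E \<iota>"
      let ?c = "\<iota> Centre" and ?s = "\<iota> (Rel {(a, b). a < b \<and> b < m})"
      have V: "?c \<in> {1..n}" "?s \<in> {1..n}"
      proof -
        have "Centre \<in> ?K" "Rel {(a, b). a < b \<and> b < m} \<in> ?K" by (auto simp: gadget_vertices_iff)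
        then show "?c \<in> {1..n}" "?s \<in> {1..n}" using copy unfolding isolated_copy_def by blast+
      qed
      have "sat {1..n} E a (size_fm f r)" if "(f, r) \<in> demands k" for f r a
        using m[OF that] V isolated_gadget_rich[OF copy] unfolding forced_def by blast
      moreover have "{1..n} \<noteq> {}" using V by auto
      ultimately show "models {1..n} E (fast_sentence k)" unfolding models_def by (auto simp: sat_fast_sentence)
    qed
  qed simp
  then show ?thesis
    by (intro tendsto_sandwich[OF _ _ lb tendsto_const])
      (auto simp: Prob_def intro!: always_eventually)
qed

lemma Prob_fast_sentence_pos:
  assumes "Prob i p (fast_sentence k) > 0" "1 \<le> i" "(f, r) \<in> demands k"
    and "\<And>n. rec_eval f [n] (g n)" "n < 2 ^ r"
  shows "g n < i"
proof -
  have "{E. models {1..i} E (fast_sentence k)} \<noteq> {}"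
  proof
    assume "{E. models {1..i} E (fast_sentence k)} = {}"
    then show False using assms(1) unfolding Prob_def by simp
  qed
  then obtain E where E: "models {1..i} E (fast_sentence k)" by blast
  have "sat {1..i} E (\<lambda>_. 1) (fast_sentence k)" using E assms(2) by (auto simp: models_def)
  then have "sat {1..i} E (\<lambda>_. 1) (size_fm f r)" using assms(2,3) by (auto simp: sat_fast_sentence)
  then have "g n < card {1..i}" using assms(4,5) by (intro size_fm_sound[of _ E _ f r]) auto
  then show ?thesis by simp
qed

text \<open>
  With \<open>r = k - D\<close> the depth is at most \<open>k\<close>, and \<open>2 ^ r \<ge> 2 r > r + D = k\<close> once \<open>r > D\<close>.
\<close>
lemma eventually_demands:
  assumes "\<And>n. rec_eval f [n] (g n)"
  shows "\<forall>\<^sub>F k in sequentially. \<exists>r. (f, r) \<in> demands k \<and> k < 2 ^ r"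
proof -
  define D where "D = qdepth (computes_fm f [4] 5) + 9"
  have "\<forall>\<^sub>F k in sequentially. to_nat f + 2 * D < k" by (rule eventually_gt_at_top)
  then show ?thesis
  proof eventually_elim
    case (elim k)
    define r where "r = k - D"
    have r: "k = r + D" "D < r" using elim by (auto simp: r_def)
    have "r \<le> 2 ^ (r - 1)" using less_exp[of "r - 1"] by linarith
    then have "2 * r \<le> 2 ^ r" using r by (cases r) auto
    then have "k < 2 ^ r" using r by linarith
    moreover have "(f, r) \<in> demands k"
      unfolding demands_def using elim qdepth_size_fm[of f r] r assms by (auto simp: D_def)
    ultimately show ?case by blast
  qed
qed

theorem theorem8:
  "\<exists>\<psi> :: nat \<Rightarrow> fm.
     (\<forall>k\<ge>1. sentence (\<psi> k) \<and> qdepth (\<psi> k) = k) \<and>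
     (\<forall>p :: nat \<Rightarrow> real.
        (\<forall>i\<ge>1. 0 < p i \<and> p i < 1) \<longrightarrow>
        (\<lambda>n. ln (\<Prod>i=1..n. 1 - p i) / ln (real n)) \<longlonglongrightarrow> 0 \<longrightarrow>
          (\<forall>k\<ge>1. (\<lambda>n. Prob n p (\<psi> k)) \<longlonglongrightarrow> 1) \<and>
          faster_than_recursive (\<lambda>k. LEAST i. 1 \<le> i \<and> Prob i p (\<psi> k) > 0))"
proof (intro exI[of _ fast_sentence] conjI allI impI)
  fix p :: "nat \<Rightarrow> real"
  assume "\<forall>i\<ge>1. 0 < p i \<and> p i < 1" and lim: "(\<lambda>n. ln (\<Prod>i=1..n. 1 - p i) / ln (real n)) \<longlonglongrightarrow> 0"
  then have p: "\<And>i. 1 \<le> i \<Longrightarrow> 0 < p i \<and> p i < 1" by blast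
  show lim1: "(\<lambda>n. Prob n p (fast_sentence k)) \<longlonglongrightarrow> 1" for k
    using Prob_fast_sentence_tendsto_1[OF p lim] .
  show "faster_than_recursive (\<lambda>k. LEAST i. 1 \<le> i \<and> Prob i p (fast_sentence k) > 0)"
    unfolding faster_than_recursive_def
  proof (intro allI impI)
    fix g assume "total_recursive g"
    then obtain f where f: "\<And>n. rec_eval f [n] (g n)" unfolding total_recursive_def by blast
    from eventually_demands[OF f]
    show "\<forall>\<^sub>F k in sequentially. g k < (LEAST i. 1 \<le> i \<and> Prob i p (fast_sentence k) > 0)"
    proof eventually_elim
      case (elim k)
      then obtain r where r: "(f, r) \<in> demands k" "k < 2 ^ r" by blast
      have "\<forall>\<^sub>F i in sequentially. Prob i p (fast_sentence k) > 0"
        by (rule order_tendstoD(1)[OF lim1]) simp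
      with eventually_ge_at_top[of 1]
      have "\<forall>\<^sub>F i in sequentially. 1 \<le> i \<and> Prob i p (fast_sentence k) > 0" by (rule eventually_conj)
      then have "\<exists>i. 1 \<le> i \<and> Prob i p (fast_sentence k) > 0"
        by (rule eventually_happens'[OF sequentially_bot])
      from LeastI_ex[OF this] show ?case using Prob_fast_sentence_pos[OF _ _ r(1) f r(2)] by blast
    qed
  qed
qed (auto simp: sentence_fast_sentence qdepth_fast_sentence)

end
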